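(* Let $F$ be a simple graph with at least one vertex, and let $G=K_2\vee F$ and $n=v(G)$. When $n\ge4$, $$Q(G)\ge \frac{27}{n^2}\left(\frac32\right)^{n-4}.$$ When $n=3$, we have $G=K_3$ and $Q(G)=4/3$.
   Context: All graphs are finite and simple; $v(G)$ denotes the number of vertices of $G$. For a graph $G$, $\alpha(G)$ is the number of acyclic orientations of $G$ and $\alpha^{*}(G)$ is the number of totally cyclic orientations of $G$ (orientations in which every edge lies on a directed cycle). For a connected graph $G$, $\tau(G)$ is the number of spanning trees of $G$. For connected $G$, define $Q(G)=\alpha(G)\alpha^{*}(G)/\tau(G)^2$. The join $A\vee B$ is obtained from the disjoint union of $A$ and $B$ by adding all edges between $V(A)$ and $V(B)$. $K_m$ is the complete graph on $m$ vertices. *)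

theory Defs
  imports Complex_Main "Graph_Theory.Graph_Theory"
begin

text \<open>
  A finite simple graph is a \<^locale>\<open>pair_graph\<close>: a finite loop-free symmetric digraph
  without parallel arcs. An edge $\{u, v\}$ is thus represented by the two arcs $(u, v)$ and $(v, u)$.
\<close>

definition graph_join ::
  "'a pair_pre_digraph \<Rightarrow> 'b pair_pre_digraph \<Rightarrow> ('a + 'b) pair_pre_digraph" where
  "graph_join A B = \<lparr>
     pverts = Inl ` pverts A \<union> Inr ` pverts B,
     parcs = {(Inl u, Inl v) | u v. (u, v) \<in> parcs A}
           \<union> {(Inr u, Inr v) | u v. (u, v) \<in> parcs B}
           \<union> Inl ` pverts A \<times> Inr ` pverts B
           \<union> Inr ` pverts B \<times> Inl ` pverts A \<rparr>"

definition orientation :: "'a pair_pre_digraph \<Rightarrow> 'a pair_pre_digraph \<Rightarrow> bool" where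
  "orientation G D \<longleftrightarrow>
     pverts D = pverts G \<and> parcs D \<subseteq> parcs G \<and>
     (\<forall>u v. (u, v) \<in> parcs G \<longrightarrow> ((u, v) \<in> parcs D) \<noteq> ((v, u) \<in> parcs D))"

text \<open>
  For a digraph, \<^const>\<open>forest\<close> of the library says that there is no directed cycle.
\<close>

definition num_acyclic_orientations :: "'a pair_pre_digraph \<Rightarrow> nat" where
  "num_acyclic_orientations G = card {D. orientation G D \<and> forest (with_proj D)}"

definition totally_cyclic :: "'a pair_pre_digraph \<Rightarrow> bool" where
  "totally_cyclic D \<longleftrightarrow>
     (\<forall>e \<in> parcs D. \<exists>p. pre_digraph.cycle (with_proj D) p \<and> e \<in> set p)"

definition num_totally_cyclic_orientations :: "'a pair_pre_digraph \<Rightarrow> nat" where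
  "num_totally_cyclic_orientations G = card {D. orientation G D \<and> totally_cyclic D}"

text \<open>
  The library's \<^const>\<open>tree\<close> and \<^const>\<open>spanning_tree\<close> are not used, since they exclude directed
  cycles, and in a symmetric digraph every edge gives the directed cycle $u, v, u$ of length 2.
  The cycles of an undirected simple graph are the directed cycles of length at least 3 of
  the corresponding symmetric digraph.
\<close>

definition undirected_tree :: "'a pair_pre_digraph \<Rightarrow> bool" where
  "undirected_tree T \<longleftrightarrow>
     pair_graph T \<and> Digraph_Component.connected (with_proj T) \<and>
     \<not> (\<exists>p. pre_digraph.cycle (with_proj T) p \<and> length p \<ge> 3)"

definition num_spanning_trees :: "'a pair_pre_digraph \<Rightarrow> nat" where
  "num_spanning_trees G =
     card {T. undirected_tree T \<and> spanning (with_proj T) (with_proj G)}"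

definition Q :: "'a pair_pre_digraph \<Rightarrow> real" where
  "Q G = real (num_acyclic_orientations G) * real (num_totally_cyclic_orientations G)
         / (real (num_spanning_trees G))\<^sup>2"

end

theory Submission
  imports Defs "HOL-Library.Multiset"
begin

text \<open>
Let $x, y$ be the two vertices of $K_2$ and write $A$, $B$, $T$ for the numbers of acyclic
orientations, of totally cyclic orientations and of spanning trees. The claim
$A B \ge c\, T^2$ with $c = \frac{27}{n^2} (\frac32)^{n-4}$ is proved for a larger class of
multigraphs, namely for all minors of $G$ that arise by deleting and contracting edges of $F$ and
then deleting loops; $n$ stays the number of vertices of $G$ itself, so that $c$ is a constant.
The induction removes one class of $p$ parallel edges $uv$ at a time. If index 0 stands for deleting
and index 1 for contracting the whole class, then
\[ A = A_0 + A_1, \qquad B = B_0 + (2^p - 1) B_1, \qquad T = T_0 + p\, T_1 . \]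
For $p = 1$ the induction step is the Cauchy-Schwarz inequality. For $p = 2, 3, 4$ one has
$2^p - 1 < p^2$, and Cauchy-Schwarz is too weak. What saves the step is
$A_0 \ge 3 A_1$ together with $B_1 \ge B_0$ and $T_1 \le T_0$: these make the cross term
$(2^p - 1) A_0 B_1$ large (\<open>step_ineq\<close>). The inequality for $B$ is obvious, as contraction keeps
an orientation strongly connected. The other two (\<open>acyclic_count_contract_le\<close>,
\<open>tree_count_contract_le\<close>) hold because $u$ and $v$ are both adjacent to $x$ and to $y$. They
survive deletion and contraction of any further edge of $F$, so it suffices to check them when no
edge of $F$ is left.

Then every vertex besides $x$ and $y$ is a class (\<^emph>\<open>block\<close>) of $s$ contracted vertices, with
$s$ edges to $x$ and $s$ edges to $y$. With $k$ blocks of sizes $s_i$,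
\[ A = 2 \cdot 3^k, \qquad
   B = 2 \Bigl(\prod (4^{s_i} - 2) - \prod (2^{s_i + 1} - 3)\Bigr), \qquad
   T = \frac n2 \prod 2 s_i , \]
which gives the base of the induction (\<open>blocks_ineq\<close>) if $n \ge 4$, and all three numbers for
$n = 3$. For $k = n - 2$ blocks of size 1 these are the values for $F$ without edges.

In the minors, totally cyclic orientations are counted as strongly connected ones. The two notions
agree because the graphs are connected.
\<close>

section \<open>Minors as contracted edge relations\<close>

text \<open>
A minor of a graph is given by the list of its remaining edges and the set \<open>C\<close> of contracted
edges. Vertices are never renamed: two of them are the same vertex of the minor iff they are linked,
and an edge is a loop iff it belongs to \<open>linked C\<close>.
\<close>

definition linked :: "'v rel \<Rightarrow> 'v rel" where
  "linked C = (C \<union> C\<inverse>)\<^sup>*"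

lemma linked_refl [simp]: "(a, a) \<in> linked C"
  by (simp add: linked_def)

lemma linked_sym: "(a, b) \<in> linked C \<Longrightarrow> (b, a) \<in> linked C"
proof -
  have "sym (C \<union> C\<inverse>)" by (auto simp: sym_def)
  then show "(a, b) \<in> linked C \<Longrightarrow> (b, a) \<in> linked C"
    unfolding linked_def by (meson sym_rtrancl symD)
qed

lemma linked_trans: "(a, b) \<in> linked C \<Longrightarrow> (b, c) \<in> linked C \<Longrightarrow> (a, c) \<in> linked C"
  unfolding linked_def by (rule rtrancl_trans)

lemma linked_base: "(a, b) \<in> C \<Longrightarrow> (a, b) \<in> linked C"
  by (auto simp: linked_def)

lemma linked_mono: "C \<subseteq> C' \<Longrightarrow> linked C \<subseteq> linked C'"
  unfolding linked_def by (intro rtrancl_mono) auto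

lemma linked_edge: "(a, b) \<in> C \<or> (b, a) \<in> C \<Longrightarrow> (a, b) \<in> linked C"
  by (auto simp: linked_def)

lemma linked_induct [consumes 1, case_names base step]:
  assumes "(a, b) \<in> linked C" and "P a"
    and "\<And>b c. (a, b) \<in> linked C \<Longrightarrow> (b, c) \<in> C \<or> (c, b) \<in> C \<Longrightarrow> P b \<Longrightarrow> P c"
  shows "P b"
  using assms(1) unfolding linked_def
proof (induction rule: rtrancl_induct)
  case (step b c)
  then show ?case using assms(3)[of b c] by (auto simp: linked_def)
qed (rule assms(2))

lemma linked_least:
  assumes "(a, b) \<in> linked C" and "\<And>a b. (a, b) \<in> C \<Longrightarrow> (a, b) \<in> linked C'"
  shows "(a, b) \<in> linked C'"
  using assms(1)
proof (induction rule: linked_induct)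
  case (step b c)
  then have "(b, c) \<in> linked C'" using assms(2)[of b c] assms(2)[of c b] linked_sym[of c b C'] by auto
  then show ?case using step.IH by (rule linked_trans[rotated])
qed simp

lemma linked_insert:
  "(a, b) \<in> linked (insert (u, v) C) \<longleftrightarrow>
     (a, b) \<in> linked C \<or> (a, u) \<in> linked C \<and> (v, b) \<in> linked C \<or>
     (a, v) \<in> linked C \<and> (u, b) \<in> linked C" (is "?L \<longleftrightarrow> ?R b")
proof
  assume ?L
  then show "?R b"
  proof (induction rule: linked_induct)
    case (step b c)
    have "(b, c) = (u, v) \<or> (b, c) = (v, u) \<or> (b, c) \<in> linked C"
      using step(2) by (auto intro: linked_edge)
    then show ?case
    proof (elim disjE)
      assume bc: "(b, c) \<in> linked C"
      show ?thesis
        using step.IH linked_trans[OF _ bc, of a] linked_trans[OF _ bc, of v]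
          linked_trans[OF _ bc, of u] by argo
    next
      assume "(b, c) = (u, v)"
      then show ?thesis using step.IH by auto
    next
      assume "(b, c) = (v, u)"
      then show ?thesis using step.IH by auto
    qed
  qed simp
next
  let ?C' = "insert (u, v) C"
  have uv: "(u, v) \<in> linked ?C'" "(v, u) \<in> linked ?C'" by (auto intro: linked_edge)
  have sub: "linked C \<subseteq> linked ?C'" by (rule linked_mono) auto
  assume "?R b"
  then show ?L
  proof (elim disjE conjE)
    assume "(a, u) \<in> linked C" "(v, b) \<in> linked C"
    then have "(a, u) \<in> linked ?C'" "(v, b) \<in> linked ?C'" using sub by auto
    then show ?L using uv(1) by (blast intro: linked_trans)
  next
    assume "(a, v) \<in> linked C" "(u, b) \<in> linked C"
    then have "(a, v) \<in> linked ?C'" "(u, b) \<in> linked ?C'" using sub by auto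
    then show ?L using uv(2) by (blast intro: linked_trans)
  qed (use sub in auto)
qed

lemma linked_insert_cong:
  "linked C = linked C' \<Longrightarrow> linked (insert e C) = linked (insert e C')"
  by (cases e) (auto simp: set_eq_iff linked_insert)

text \<open>
Used with \<open>S\<close> the set of remaining edges: if none of them meets the class of \<open>k\<close>, then \<open>k\<close> is
an isolated vertex of the minor.
\<close>

lemma linked_avoid:
  assumes "(k, b) \<in> linked (C \<union> S)"
    and "\<And>a b. (a, b) \<in> S \<Longrightarrow> (k, a) \<notin> linked C \<and> (k, b) \<notin> linked C"
  shows "(k, b) \<in> linked C"
  using assms(1)
proof (induction rule: linked_induct)
  case (step b c)
  then have "(b, c) \<in> C \<or> (c, b) \<in> C" using assms(2) by blast
  then have "(b, c) \<in> linked C" by (rule linked_edge)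
  then show ?case using step.IH by (rule linked_trans[rotated])
qed simp

text \<open>
Two edges are parallel in the minor if they have the same ends up to linking.
\<close>

definition parallel :: "'v rel \<Rightarrow> 'v \<times> 'v \<Rightarrow> 'v \<times> 'v \<Rightarrow> bool" where
  "parallel C e f \<longleftrightarrow>
     (fst e, fst f) \<in> linked C \<and> (snd e, snd f) \<in> linked C \<or>
     (fst e, snd f) \<in> linked C \<and> (snd e, fst f) \<in> linked C"

text \<open>
Contracting an edge turns exactly its parallel edges into new loops.
\<close>

lemma linked_insert_iff:
  "e \<in> linked (insert f C) \<longleftrightarrow> e \<in> linked C \<or> parallel C e f"
  by (cases e; cases f) (auto simp: parallel_def linked_insert linked_sym)

lemma parallel_sym: "parallel C e f \<Longrightarrow> parallel C f e"
  by (auto simp: parallel_def intro: linked_sym)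

lemma parallel_refl [simp]: "parallel C e e" by (simp add: parallel_def)

lemma linked_insert_subset:
  assumes "e \<in> linked (insert f C)" shows "linked (insert e C) \<subseteq> linked (insert f C)"
proof (intro subrelI)
  fix a b assume "(a, b) \<in> linked (insert e C)"
  then show "(a, b) \<in> linked (insert f C)"
    by (rule linked_least) (use assms in \<open>auto intro: linked_base\<close>)
qed

lemma linked_insert_absorb:
  assumes "e \<in> linked C" shows "linked (insert e C) = linked C"
proof
  show "linked (insert e C) \<subseteq> linked C"
    by (intro subrelI, erule linked_least) (use assms in \<open>auto intro: linked_base\<close>)
qed (auto intro: linked_mono[THEN subsetD])

lemma parallel_insert_eq:
  assumes "parallel C e f" shows "linked (insert e C) = linked (insert f C)"
  using assms parallel_sym linked_insert_iff linked_insert_subset by (metis subset_antisym)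

lemma parallel_loop:
  assumes "parallel C e f" "e \<in> linked C" shows "f \<in> linked C"
proof -
  have "f \<in> linked (insert e C)"
    using assms(1) parallel_sym linked_insert_iff by blast
  then show ?thesis using linked_insert_absorb[OF assms(2)] by simp
qed

lemma parallel_linked_insert: "parallel C e p \<Longrightarrow> p \<in> linked (insert e C)"
  by (simp add: linked_insert_iff parallel_sym)

section \<open>Sums over the orientations of an edge list\<close>

text \<open>
The sum of \<open>f\<close> over all orientations of the listed edges. Summing a general function makes
deletion-contraction identities provable for one orientation of the other edges at a time.
\<close>

fun orient_sum :: "('v \<times> 'v) list \<Rightarrow> ('v rel \<Rightarrow> nat) \<Rightarrow> nat" where
  "orient_sum [] f = f {}"
| "orient_sum ((u, v) # es) f =
     orient_sum es (\<lambda>R. f (insert (u, v) R)) + orient_sum es (\<lambda>R. f (insert (v, u) R))"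

lemma orient_sum_add:
  "orient_sum es (\<lambda>R. f R + g R) = orient_sum es f + orient_sum es g"
  by (induction es f arbitrary: g rule: orient_sum.induct) (simp_all)

lemma orient_sum_zero: "orient_sum es (\<lambda>R. 0) = 0"
proof (induction es)
  case (Cons e es)
  then show ?case by (cases e) simp
qed simp

text \<open>
The two conditions on \<open>R\<close> record what is known of an orientation: it directs every listed edge, and
has no other arcs.
\<close>

lemma orient_sum_mono:
  assumes "\<And>R. set es \<subseteq> R \<union> R\<inverse> \<Longrightarrow> R \<subseteq> set es \<union> (set es)\<inverse> \<Longrightarrow> f R \<le> g R"
  shows "orient_sum es f \<le> orient_sum es g"
  using assms
proof (induction es f arbitrary: g rule: orient_sum.induct)
  case (2 u v es f)
  have "orient_sum es (\<lambda>R. f (insert (u, v) R)) \<le> orient_sum es (\<lambda>R. g (insert (u, v) R))"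
    by (rule 2(1), rule 2(3)) auto
  moreover have "orient_sum es (\<lambda>R. f (insert (v, u) R)) \<le> orient_sum es (\<lambda>R. g (insert (v, u) R))"
    by (rule 2(2), rule 2(3)) auto
  ultimately show ?case by simp
qed simp

lemma orient_sum_cong:
  assumes "\<And>R. set es \<subseteq> R \<union> R\<inverse> \<Longrightarrow> R \<subseteq> set es \<union> (set es)\<inverse> \<Longrightarrow> f R = g R"
  shows "orient_sum es f = orient_sum es g"
  by (intro antisym orient_sum_mono) (simp_all add: assms)

lemma orient_sum_move: "orient_sum (l @ e # r) f = orient_sum (e # l @ r) f"
proof (induction l arbitrary: f)
  case (Cons a l)
  then show ?case by (cases a; cases e) (simp add: insert_commute)
qed simp

lemma orient_sum_perm: "mset es = mset es' \<Longrightarrow> orient_sum es f = orient_sum es' f"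
proof (induction es arbitrary: es' f)
  case (Cons e es)
  then have "e \<in> set es'" by (metis list.set_intros(1) mset_eq_setD)
  then obtain l r where es': "es' = l @ e # r" by (meson split_list)
  then have "mset es = mset (l @ r)" using Cons.prems by simp
  then show ?case using Cons.IH[of "l @ r"] es' by (cases e) (simp add: orient_sum_move)
qed simp

section \<open>Acyclic orientations of a minor\<close>

text \<open>
Contracted edges may be used freely in both directions, so this says that no arc of \<open>R\<close> lies on a
directed cycle of the minor.
\<close>

definition acyclic_mod :: "'v rel \<Rightarrow> 'v rel \<Rightarrow> bool" where
  "acyclic_mod C R \<longleftrightarrow> (\<forall>(a, b)\<in>R. (b, a) \<notin> (R \<union> linked C)\<^sup>*)"

definition acyclic_count :: "('v \<times> 'v) list \<Rightarrow> 'v rel \<Rightarrow> nat" where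
  "acyclic_count es C = orient_sum es (\<lambda>R. of_bool (acyclic_mod C R))"

lemma acyclic_count_perm: "mset es = mset es' \<Longrightarrow> acyclic_count es C = acyclic_count es' C"
  unfolding acyclic_count_def by (rule orient_sum_perm)

lemma acyclic_count_cong: "linked C = linked C' \<Longrightarrow> acyclic_count es C = acyclic_count es C'"
  by (simp add: acyclic_count_def acyclic_mod_def)

lemma acyclic_count_loop_hd:
  assumes "(u, v) \<in> linked C" shows "acyclic_count ((u, v) # es) C = 0"
proof -
  have "\<not> acyclic_mod C (insert (u, v) R)" "\<not> acyclic_mod C (insert (v, u) R)" for R
    using assms linked_sym[OF assms] by (auto simp: acyclic_mod_def)
  then show ?thesis by (simp add: acyclic_count_def orient_sum_zero)
qed

lemma acyclic_count_loop:
  assumes "e \<in> set es" "e \<in> linked C" shows "acyclic_count es C = 0"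
proof -
  obtain l r where "es = l @ e # r" using assms(1) by (meson split_list)
  then have "acyclic_count es C = acyclic_count (e # l @ r) C" by (intro acyclic_count_perm) simp
  then show ?thesis using assms(2) acyclic_count_loop_hd by (metis prod.collapse)
qed

lemma path_uses_edge:
  assumes "(v, u) \<in> (R \<union> L)\<^sup>*" "(v, u) \<notin> L\<^sup>*"
  obtains a b where "(a, b) \<in> R" "(v, a) \<in> (R \<union> L)\<^sup>*" "(b, u) \<in> (R \<union> L)\<^sup>*"
proof -
  have "(v, u) \<in> L\<^sup>* \<or> (\<exists>a b. (a, b) \<in> R \<and> (v, a) \<in> (R \<union> L)\<^sup>* \<and> (b, u) \<in> (R \<union> L)\<^sup>*)"
    using assms(1)
  proof (induction rule: rtrancl_induct)
    case (step w z)
    then show ?case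
      by (metis UnE rtrancl.rtrancl_into_rtrancl rtrancl.rtrancl_refl Un_iff)
  qed auto
  then show ?thesis using assms(2) that by blast
qed

lemma linked_rtrancl [simp]: "(linked C)\<^sup>* = linked C"
  by (simp add: linked_def)

lemma rtrancl_un_linked_insert:
  "(R \<union> linked (insert (u, v) C))\<^sup>* = (insert (u, v) (insert (v, u) (R \<union> linked C)))\<^sup>*"
    (is "?A = ?B")
proof
  have "linked (insert (u, v) C) \<subseteq> ?B"
    unfolding linked_def[of "insert (u, v) C"]
    by (intro rtrancl_mono) (auto intro: linked_base linked_sym[OF linked_base])
  then have "R \<union> linked (insert (u, v) C) \<subseteq> ?B" by auto
  then show "?A \<subseteq> ?B" by (metis rtrancl_idemp rtrancl_mono)
  have "(u, v) \<in> linked (insert (u, v) C)" "(v, u) \<in> linked (insert (u, v) C)"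
    by (auto intro: linked_base linked_sym[OF linked_base])
  moreover have "linked C \<subseteq> linked (insert (u, v) C)" by (intro linked_mono) auto
  ultimately show "?B \<subseteq> ?A" by (intro rtrancl_mono) auto
qed

lemma rtrancl_insert_iff:
  "(a, b) \<in> (insert (u, v) D)\<^sup>* \<longleftrightarrow> (a, b) \<in> D\<^sup>* \<or> (a, u) \<in> D\<^sup>* \<and> (v, b) \<in> D\<^sup>*"
  by (simp add: rtrancl_insert)

lemma acyclic_mod_insert:
  "acyclic_mod C (insert (u, v) R) \<longleftrightarrow> acyclic_mod C R \<and> (v, u) \<notin> (R \<union> linked C)\<^sup>*"
proof -
  let ?W = "(R \<union> linked C)\<^sup>*"
  have tr: "(a, b) \<in> ?W \<Longrightarrow> (b, c) \<in> ?W \<Longrightarrow> (a, c) \<in> ?W" for a b c by (rule rtrancl_trans)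
  have e: "(a, b) \<in> R \<Longrightarrow> (a, b) \<in> ?W" for a b by auto
  show ?thesis
    unfolding acyclic_mod_def by (auto simp: rtrancl_insert_iff) (meson tr e)+
qed

text \<open>
A directed cycle that is created by merging \<open>u\<close> and \<open>v\<close> is a directed path between them. As \<open>u\<close> and
\<open>v\<close> are not linked, such a path uses some arc of \<open>R\<close>, which then lies on the cycle.
\<close>

lemma acyclic_mod_contract:
  assumes "(u, v) \<notin> linked C"
  shows "acyclic_mod (insert (u, v) C) R \<longleftrightarrow>
    acyclic_mod C R \<and> (v, u) \<notin> (R \<union> linked C)\<^sup>* \<and> (u, v) \<notin> (R \<union> linked C)\<^sup>*"
proof -
  let ?W = "(R \<union> linked C)\<^sup>*"
  have tr: "(a, b) \<in> ?W \<Longrightarrow> (b, c) \<in> ?W \<Longrightarrow> (a, c) \<in> ?W" for a b c by (rule rtrancl_trans)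
  have e: "(a, b) \<in> R \<Longrightarrow> (a, b) \<in> ?W" for a b by auto
  have 1: "\<exists>(a, b)\<in>R. (b, a) \<in> (R \<union> linked (insert (u, v) C))\<^sup>*" if vu: "(v, u) \<in> ?W"
  proof -
    obtain a b where "(a, b) \<in> R" "(v, a) \<in> ?W" "(b, u) \<in> ?W"
      using path_uses_edge[OF vu] assms linked_sym[of v u C] by auto
    then show ?thesis by (auto simp: rtrancl_un_linked_insert rtrancl_insert_iff)
  qed
  have 2: "\<exists>(a, b)\<in>R. (b, a) \<in> (R \<union> linked (insert (u, v) C))\<^sup>*" if uv: "(u, v) \<in> ?W"
  proof -
    obtain a b where "(a, b) \<in> R" "(u, a) \<in> ?W" "(b, v) \<in> ?W"
      using path_uses_edge[OF uv] assms by auto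
    then show ?thesis by (auto simp: rtrancl_un_linked_insert rtrancl_insert_iff)
  qed
  have 3: "(b, a) \<notin> (R \<union> linked (insert (u, v) C))\<^sup>*"
    if "acyclic_mod C R" "(v, u) \<notin> ?W" "(u, v) \<notin> ?W" "(a, b) \<in> R" for a b
  proof
    assume "(b, a) \<in> (R \<union> linked (insert (u, v) C))\<^sup>*"
    moreover have "(b, a) \<notin> ?W" using that by (auto simp: acyclic_mod_def)
    ultimately show False
      using that(2,3) e[OF that(4)] unfolding rtrancl_un_linked_insert rtrancl_insert_iff
      by (meson tr)
  qed
  have 4: "acyclic_mod (insert (u, v) C) R \<Longrightarrow> acyclic_mod C R"
    unfolding acyclic_mod_def rtrancl_un_linked_insert by (auto simp: rtrancl_insert_iff)
  show ?thesis using 1 2 3 4 unfolding acyclic_mod_def by blast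
qed

text \<open>
Fix an acyclic orientation of the other edges. At most one of the paths from \<open>u\<close> to \<open>v\<close> and from \<open>v\<close>
to \<open>u\<close> exists, so at least one direction of the new edge is admissible. Both are admissible iff
neither path exists, which is when the contraction is acyclic.
\<close>

lemma acyclic_count_delete_contract:
  assumes "(u, v) \<notin> linked C"
  shows "acyclic_count ((u, v) # es) C = acyclic_count es C + acyclic_count es (insert (u, v) C)"
proof -
  have "of_bool (acyclic_mod C (insert (u, v) R)) + of_bool (acyclic_mod C (insert (v, u) R)) =
      of_bool (acyclic_mod C R) + (of_bool (acyclic_mod (insert (u, v) C) R) :: nat)" for R
  proof -
    let ?W = "(R \<union> linked C)\<^sup>*"
    have "\<not> acyclic_mod C R" if uv: "(u, v) \<in> ?W" and vu: "(v, u) \<in> ?W"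
    proof -
      obtain a b where "(a, b) \<in> R" "(u, a) \<in> ?W" "(b, v) \<in> ?W"
        using uv assms by (metis path_uses_edge linked_rtrancl)
      moreover from this vu have "(b, a) \<in> ?W" by (meson rtrancl_trans)
      ultimately show ?thesis by (auto simp: acyclic_mod_def)
    qed
    then show ?thesis by (auto simp: acyclic_mod_insert acyclic_mod_contract[OF assms])
  qed
  then show ?thesis by (simp add: acyclic_count_def flip: orient_sum_add)
qed

section \<open>Strongly connected orientations of a minor\<close>

definition strong :: "'v set \<Rightarrow> 'v rel \<Rightarrow> bool" where
  "strong V D \<longleftrightarrow> (\<forall>a\<in>V. \<forall>b\<in>V. (a, b) \<in> D\<^sup>*)"

definition strong_count :: "'v set \<Rightarrow> ('v \<times> 'v) list \<Rightarrow> 'v rel \<Rightarrow> nat" where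
  "strong_count V es C = orient_sum es (\<lambda>R. of_bool (strong V (R \<union> linked C)))"

lemma strong_count_perm: "mset es = mset es' \<Longrightarrow> strong_count V es C = strong_count V es' C"
  unfolding strong_count_def by (rule orient_sum_perm)

lemma strong_count_cong: "linked C = linked C' \<Longrightarrow> strong_count V es C = strong_count V es C'"
  by (simp add: strong_count_def)

lemma strong_mono: "strong V D \<Longrightarrow> D \<subseteq> D'\<^sup>* \<Longrightarrow> strong V D'"
  using rtrancl_subset_rtrancl[of D D'] by (auto simp: strong_def)

lemma strong_count_contract_mono: "strong_count V es C \<le> strong_count V es (insert e C)"
  unfolding strong_count_def
proof (intro orient_sum_mono)
  fix R :: "'a rel"
  have "linked C \<subseteq> linked (insert e C)" by (intro linked_mono) auto
  then have "R \<union> linked C \<subseteq> (R \<union> linked (insert e C))\<^sup>*" by auto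
  then have "strong V (R \<union> linked C) \<Longrightarrow> strong V (R \<union> linked (insert e C))"
    by (rule strong_mono[rotated])
  then show "of_bool (strong V (R \<union> linked C)) \<le> (of_bool (strong V (R \<union> linked (insert e C))) :: nat)"
    by simp
qed

lemma strong_count_loop:
  assumes "(u, v) \<in> linked C" shows "strong_count V ((u, v) # es) C = 2 * strong_count V es C"
proof -
  have "insert (u, v) (R \<union> linked C) = R \<union> linked C" "insert (v, u) (R \<union> linked C) = R \<union> linked C" for R
    using assms linked_sym[OF assms] by auto
  then show ?thesis by (simp add: strong_count_def)
qed

text \<open>
Being equal is included, so that the path \<open>u\<close>, \<open>w\<close>, \<open>v\<close> below may be a single edge.
\<close>

definition adjacent_mod :: "('v \<times> 'v) list \<Rightarrow> 'v rel \<Rightarrow> 'v \<Rightarrow> 'v \<Rightarrow> bool" where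
  "adjacent_mod es C a b \<longleftrightarrow> (a, b) \<in> linked C \<or> (\<exists>f\<in>set es. parallel C (a, b) f)"

text \<open>
If the graph becomes strongly connected by merging \<open>u\<close> and \<open>v\<close>, then inserting the arc \<open>(u, v)\<close>
makes it strongly connected iff there is a path back from \<open>v\<close> to \<open>u\<close>. The assumptions on \<open>w\<close> ensure
that at least one of the two paths between \<open>u\<close> and \<open>v\<close> exists; both exist iff the graph was strongly
connected before.
\<close>

lemma strong_delete_contract:
  assumes V: "u \<in> V" "v \<in> V" "w \<in> V"
    and uw: "(u, w) \<in> D\<^sup>* \<or> (w, u) \<in> D\<^sup>*" and wv: "(w, v) \<in> D\<^sup>* \<or> (v, w) \<in> D\<^sup>*"
  shows "of_bool (strong V (insert (u, v) D)) + of_bool (strong V (insert (v, u) D)) =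
      of_bool (strong V D) + (of_bool (strong V (insert (u, v) (insert (v, u) D))) :: nat)"
proof -
  let ?D' = "insert (u, v) (insert (v, u) D)"
  have tr: "(a, b) \<in> E\<^sup>* \<Longrightarrow> (b, c) \<in> E\<^sup>* \<Longrightarrow> (a, c) \<in> E\<^sup>*" for a b c and E :: "'a rel"
    by (rule rtrancl_trans)
  have sub: "strong V E \<Longrightarrow> strong V ?D'" if "E \<subseteq> ?D'" for E
    by (erule strong_mono) (use that in auto)
  have add: "strong V E" if "strong V ?D'" "(u, v) \<in> E\<^sup>*" "(v, u) \<in> E\<^sup>*" "D \<subseteq> E" for E
    by (rule strong_mono[OF that(1)]) (use that in auto)
  have 1: "strong V (insert (u, v) D) \<longleftrightarrow> (v, u) \<in> D\<^sup>* \<and> strong V ?D'"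
  proof
    assume *: "strong V (insert (u, v) D)"
    then have "(v, u) \<in> (insert (u, v) D)\<^sup>*" using V by (simp add: strong_def)
    then show "(v, u) \<in> D\<^sup>* \<and> strong V ?D'"
      using sub[OF _ *] by (auto simp: rtrancl_insert_iff)
  next
    assume *: "(v, u) \<in> D\<^sup>* \<and> strong V ?D'"
    then show "strong V (insert (u, v) D)"
      by - (rule add; auto simp: rtrancl_insert_iff)
  qed
  have 2: "strong V (insert (v, u) D) \<longleftrightarrow> (u, v) \<in> D\<^sup>* \<and> strong V ?D'"
  proof
    assume *: "strong V (insert (v, u) D)"
    then have "(u, v) \<in> (insert (v, u) D)\<^sup>*" using V by (simp add: strong_def)
    then show "(u, v) \<in> D\<^sup>* \<and> strong V ?D'"
      using sub[OF _ *] by (auto simp: rtrancl_insert_iff)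
  next
    assume *: "(u, v) \<in> D\<^sup>* \<and> strong V ?D'"
    then show "strong V (insert (v, u) D)"
      by - (rule add; auto simp: rtrancl_insert_iff)
  qed
  have 3: "strong V D \<longleftrightarrow> (u, v) \<in> D\<^sup>* \<and> (v, u) \<in> D\<^sup>* \<and> strong V ?D'"
  proof
    assume *: "strong V D"
    then have "(u, v) \<in> D\<^sup>*" "(v, u) \<in> D\<^sup>*" using V by (simp_all add: strong_def)
    then show "(u, v) \<in> D\<^sup>* \<and> (v, u) \<in> D\<^sup>* \<and> strong V ?D'" using sub[OF _ *] by blast
  next
    assume "(u, v) \<in> D\<^sup>* \<and> (v, u) \<in> D\<^sup>* \<and> strong V ?D'"
    then show "strong V D" by - (rule add; auto)
  qed
  have 4: "(u, v) \<in> D\<^sup>* \<or> (v, u) \<in> D\<^sup>*" if *: "strong V ?D'"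
  proof -
    have "(w, u) \<in> ?D'\<^sup>*" "(u, w) \<in> ?D'\<^sup>*" using * V by (simp_all add: strong_def)
    then have "(w, u) \<in> D\<^sup>* \<or> (w, v) \<in> D\<^sup>*" "(u, w) \<in> D\<^sup>* \<or> (v, w) \<in> D\<^sup>* \<or> (u, v) \<in> D\<^sup>*"
      unfolding rtrancl_insert_iff by argo+
    then show ?thesis using uw wv
      using tr[of u w D v] tr[of v w D u] by argo
  qed
  show ?thesis using 1 2 3 4 by auto
qed

lemma adjacent_mod_oriented:
  assumes "adjacent_mod es C a b" and R: "set es \<subseteq> R \<union> R\<inverse>"
  shows "(a, b) \<in> (R \<union> linked C)\<^sup>* \<or> (b, a) \<in> (R \<union> linked C)\<^sup>*"
proof -
  let ?D = "R \<union> linked C"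
  have L: "(c, d) \<in> ?D\<^sup>*" "(d, c) \<in> ?D\<^sup>*" if "(c, d) \<in> linked C" for c d
    using that linked_sym[OF that] by auto
  have tr3: "(c, f) \<in> ?D\<^sup>*" if "(c, d) \<in> ?D\<^sup>*" "(d, e) \<in> ?D" "(e, f) \<in> ?D\<^sup>*" for c d e f
    using that by (meson rtrancl.rtrancl_into_rtrancl rtrancl_trans)
  consider "(a, b) \<in> linked C" | c d where "(c, d) \<in> set es" "parallel C (a, b) (c, d)"
    using assms(1) by (auto simp: adjacent_mod_def)
  then show ?thesis
  proof cases
    case 2
    then have "(c, d) \<in> ?D \<or> (d, c) \<in> ?D" using R by auto
    then show ?thesis
      using 2(2) tr3[OF L(1) _ L(2), of a c d b] tr3[OF L(1) _ L(2), of a d c b]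
        tr3[OF L(1) _ L(2), of b c d a] tr3[OF L(1) _ L(2), of b d c a]
      unfolding parallel_def by auto
  qed (use L in auto)
qed

text \<open>
The common neighbour \<open>w\<close> shows that the edge is not a bridge. For a bridge the left side is 0, while
the right side need not be.
\<close>

lemma strong_count_delete_contract:
  assumes V: "u \<in> V" "v \<in> V" "w \<in> V" and uw: "adjacent_mod es C u w" and wv: "adjacent_mod es C w v"
  shows "strong_count V ((u, v) # es) C = strong_count V es C + strong_count V es (insert (u, v) C)"
proof -
  have "orient_sum es (\<lambda>R. of_bool (strong V (insert (u, v) R \<union> linked C)) +
        of_bool (strong V (insert (v, u) R \<union> linked C))) =
      orient_sum es (\<lambda>R. of_bool (strong V (R \<union> linked C)) +
        of_bool (strong V (R \<union> linked (insert (u, v) C))))"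
  proof (rule orient_sum_cong)
    fix R assume R: "set es \<subseteq> R \<union> R\<inverse>"
    have "(a, b) \<in> (R \<union> linked C)\<^sup>* \<or> (b, a) \<in> (R \<union> linked C)\<^sup>*" if "adjacent_mod es C a b" for a b
      by (rule adjacent_mod_oriented[OF that R])
    moreover have "strong V (R \<union> linked (insert (u, v) C)) =
        strong V (insert (u, v) (insert (v, u) (R \<union> linked C)))"
      by (simp add: strong_def rtrancl_un_linked_insert)
    ultimately show "of_bool (strong V (insert (u, v) R \<union> linked C)) +
        of_bool (strong V (insert (v, u) R \<union> linked C)) =
        of_bool (strong V (R \<union> linked C)) +
        (of_bool (strong V (R \<union> linked (insert (u, v) C))) :: nat)"
      using strong_delete_contract[OF V, of "R \<union> linked C"] uw wv by simp
  qed
  then show ?thesis by (simp add: strong_count_def orient_sum_add)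
qed

lemma strong_count_bridge:
  assumes "u \<in> V" "v \<in> V" "(u, v) \<notin> linked (C \<union> set es)"
  shows "strong_count V ((u, v) # es) C = 0"
proof -
  have "\<not> strong V (insert (u, v) R \<union> linked C)" "\<not> strong V (insert (v, u) R \<union> linked C)"
    if R: "R \<subseteq> set es \<union> (set es)\<inverse>" for R
  proof -
    have "linked C \<subseteq> linked (C \<union> set es)" by (intro linked_mono) auto
    moreover have "R \<subseteq> linked (C \<union> set es)"
      using R by (auto intro!: linked_edge)
    ultimately have "(R \<union> linked C)\<^sup>* \<subseteq> linked (C \<union> set es)"
      by (subst linked_rtrancl[symmetric]) (intro rtrancl_mono Un_least)
    moreover have "(v, u) \<notin> linked (C \<union> set es)" using assms(3) by (auto dest: linked_sym)
    ultimately have "(u, v) \<notin> (R \<union> linked C)\<^sup>*" "(v, u) \<notin> (R \<union> linked C)\<^sup>*"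
      using assms(3) by auto
    then show "\<not> strong V (insert (u, v) R \<union> linked C)" "\<not> strong V (insert (v, u) R \<union> linked C)"
      using assms(1,2) by (auto simp: strong_def rtrancl_insert_iff)
  qed
  then have "orient_sum es (\<lambda>R. of_bool (strong V (insert (u, v) R \<union> linked C)) +
        of_bool (strong V (insert (v, u) R \<union> linked C))) = orient_sum es (\<lambda>R. 0)"
    by (intro orient_sum_cong) simp
  then show ?thesis by (simp add: strong_count_def orient_sum_add orient_sum_zero)
qed

section \<open>Spanning trees of a minor\<close>

text \<open>
Trees are built edge by edge: an edge is left out, or is taken and contracted if it is not a loop.
\<close>

fun tree_count :: "'v set \<Rightarrow> ('v \<times> 'v) list \<Rightarrow> 'v rel \<Rightarrow> nat" where
  "tree_count V [] C = of_bool (V \<times> V \<subseteq> linked C)"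
| "tree_count V (e # es) C = tree_count V es C + (if e \<in> linked C then 0 else tree_count V es (insert e C))"

lemma tree_count_cong: "linked C = linked C' \<Longrightarrow> tree_count V es C = tree_count V es C'"
proof (induction V es C arbitrary: C' rule: tree_count.induct)
  case (2 V e es C)
  show ?case using 2(1)[OF 2(3)] 2(2)[OF _ linked_insert_cong[OF 2(3)]] 2(3) by simp
qed simp

text \<open>
Both orders allow the same pairs: two proper edges cannot both be taken iff they are parallel, and
parallelism is symmetric.
\<close>

lemma tree_count_swap: "tree_count V (e # f # es) C = tree_count V (f # e # es) C"
proof -
  have "parallel C f e = parallel C e f" using parallel_sym by blast
  then show ?thesis by (simp add: linked_insert_iff insert_commute)
qed

lemma tree_count_move: "tree_count V (l @ e # r) C = tree_count V (e # l @ r) C"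
proof (induction l arbitrary: C)
  case (Cons a l)
  have "tree_count V (a # l @ e # r) C = tree_count V (a # e # l @ r) C" using Cons.IH by simp
  also have "\<dots> = tree_count V (e # a # l @ r) C" by (rule tree_count_swap)
  finally show ?case by simp
qed simp

lemma tree_count_perm: "mset es = mset es' \<Longrightarrow> tree_count V es C = tree_count V es' C"
proof (induction es arbitrary: es' C)
  case (Cons e es)
  then have "e \<in> set es'" by (metis list.set_intros(1) mset_eq_setD)
  then obtain l r where es': "es' = l @ e # r" by (meson split_list)
  then have "mset es = mset (l @ r)" using Cons.prems by simp
  then show ?case using Cons.IH[of "l @ r"] es' by (simp add: tree_count_move)
qed simp

lemma tree_count_disconnected: "\<not> V \<times> V \<subseteq> linked (C \<union> set es) \<Longrightarrow> tree_count V es C = 0"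
proof (induction V es C rule: tree_count.induct)
  case (2 V e es C)
  have "linked (C \<union> set es) \<subseteq> linked (C \<union> set (e # es))" by (intro linked_mono) auto
  then show ?case using 2 by auto
qed simp

section \<open>Deletion and contraction of a parallel class\<close>

text \<open>
Once an edge of the class is contracted, the others are loops, and a loop has no acyclic orientation.
Thus only contracting the last edge of the class contributes.
\<close>

lemma acyclic_count_parallel:
  assumes "ps \<noteq> []" "\<forall>p\<in>set ps. parallel C e p" "e \<notin> linked C"
  shows "acyclic_count (ps @ es) C = acyclic_count es C + acyclic_count es (insert e C)"
  using assms(1,2)
proof (induction ps)
  case (Cons p qs)
  obtain a b where p: "p = (a, b)" by fastforce
  have pe: "parallel C p e" using Cons.prems(2) by (simp add: parallel_sym)
  have "p \<notin> linked C" using parallel_loop[OF pe] assms(3) by blast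
  then have 1: "acyclic_count (p # qs @ es) C = acyclic_count (qs @ es) C + acyclic_count (qs @ es) (insert p C)"
    using acyclic_count_delete_contract[of a b C "qs @ es"] by (simp add: p)
  have 2: "linked (insert p C) = linked (insert e C)" using pe by (rule parallel_insert_eq)
  show ?case
  proof (cases qs)
    case Nil
    then show ?thesis using 1 acyclic_count_cong[OF 2, of es] by simp
  next
    case (Cons q qs')
    have "q \<in> linked (insert p C)"
      using Cons Cons.prems(2) parallel_linked_insert[of C e q] by (simp add: 2)
    then have "acyclic_count (qs @ es) (insert p C) = 0" using Cons by (intro acyclic_count_loop[of q]) auto
    then show ?thesis using 1 Cons.IH Cons.prems Cons by simp
  qed
qed simp

lemma strong_count_loops:
  "\<forall>p\<in>set ps. p \<in> linked C \<Longrightarrow> strong_count V (ps @ es) C = 2 ^ length ps * strong_count V es C"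
proof (induction ps)
  case (Cons p ps)
  then show ?case using strong_count_loop[of "fst p" "snd p" C V "ps @ es"] by simp
qed simp

lemma adjacent_mod_sym: "adjacent_mod es C a b \<Longrightarrow> adjacent_mod es C b a"
  unfolding adjacent_mod_def parallel_def using linked_sym[of a b C] by auto

lemma adjacent_mod_linked:
  assumes "adjacent_mod es C a w" "(b, a) \<in> linked C" shows "adjacent_mod es C b w"
proof -
  have "(b, c) \<in> linked C" if "(a, c) \<in> linked C" for c using assms(2) that by (rule linked_trans)
  then show ?thesis using assms(1) unfolding adjacent_mod_def parallel_def by auto
qed

lemma adjacent_mod_edge: "(a, b) \<in> set es \<Longrightarrow> adjacent_mod es C a b"
  unfolding adjacent_mod_def by (intro disjI2 bexI[of _ "(a, b)"]) simp

lemma adjacent_mod_mono: "adjacent_mod es C a b \<Longrightarrow> set es \<subseteq> set es' \<Longrightarrow> adjacent_mod es' C a b"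
  unfolding adjacent_mod_def by blast

lemma strong_count_delete_contract_parallel:
  assumes V: "u \<in> V" "v \<in> V" "w \<in> V" and uw: "adjacent_mod es C u w" and wv: "adjacent_mod es C w v"
    and p: "parallel C (u, v) p" "p \<in> V \<times> V" and ps: "\<forall>q\<in>set qs. parallel C (u, v) q"
  shows "strong_count V (p # qs @ es) C = strong_count V (qs @ es) C + 2 ^ length qs * strong_count V es (insert (u, v) C)"
proof -
  obtain a b where ab: "p = (a, b)" by fastforce
  have sub: "set es \<subseteq> set (qs @ es)" by simp
  consider "(a, u) \<in> linked C" "(b, v) \<in> linked C" | "(a, v) \<in> linked C" "(b, u) \<in> linked C"
    using p(1) by (auto simp: ab parallel_def intro: linked_sym)
  then have "adjacent_mod es C a w \<and> adjacent_mod es C w b"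
  proof cases
    case 1
    then show ?thesis using adjacent_mod_linked[OF uw, of a] adjacent_mod_linked[OF adjacent_mod_sym[OF wv], of b] adjacent_mod_sym[of es C b w] by simp
  next
    case 2
    then show ?thesis using adjacent_mod_linked[OF uw, of b] adjacent_mod_linked[OF adjacent_mod_sym[OF wv], of a] adjacent_mod_sym[of es C b w] by simp
  qed
  then have "strong_count V (p # qs @ es) C = strong_count V (qs @ es) C + strong_count V (qs @ es) (insert p C)"
    using strong_count_delete_contract[of a V b w "qs @ es" C] adjacent_mod_mono[OF _ sub] p V by (simp add: ab)
  moreover have eq: "linked (insert p C) = linked (insert (u, v) C)"
    using parallel_insert_eq[OF p(1)] by simp
  moreover have "\<forall>q\<in>set qs. q \<in> linked (insert (u, v) C)"
    using ps parallel_linked_insert by blast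
  ultimately show ?thesis using strong_count_loops[of qs "insert (u, v) C" V es] strong_count_cong[OF eq] by simp
qed

text \<open>
When an edge of the class is contracted, the $q$ edges of the class that remain are loops, which
double the count each. The contracted terms add up to $1 + 2 + \dots + 2^{p-1}$.
\<close>

lemma strong_count_parallel:
  assumes V: "u \<in> V" "v \<in> V" "w \<in> V" and uw: "adjacent_mod es C u w" and wv: "adjacent_mod es C w v"
    and "\<forall>p\<in>set ps. parallel C (u, v) p \<and> p \<in> V \<times> V"
  shows "strong_count V (ps @ es) C = strong_count V es C + (2 ^ length ps - 1) * strong_count V es (insert (u, v) C)"
  using assms(6)
proof (induction ps)
  case (Cons p ps)
  have "strong_count V (p # ps @ es) C = strong_count V (ps @ es) C + 2 ^ length ps * strong_count V es (insert (u, v) C)"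
    using Cons.prems by (intro strong_count_delete_contract_parallel[OF V uw wv]) auto
  moreover have "(2::nat) ^ length (p # ps) - 1 = (2 ^ length ps - 1) + 2 ^ length ps" by simp
  ultimately show ?case using Cons by (simp only: append_Cons add_mult_distrib) simp
qed simp

text \<open>
Here the class is all that joins its two ends. As for \<open>strong_count_parallel\<close>, except that the last
edge is a bridge and contributes nothing, so the term 1 is missing from the geometric sum.
\<close>

lemma strong_count_bond:
  assumes V: "u \<in> V" "v \<in> V" and uv: "(u, v) \<notin> linked (C \<union> set es)"
    and "ps \<noteq> []" "\<forall>p\<in>set ps. parallel C (u, v) p \<and> p \<in> V \<times> V"
  shows "strong_count V (ps @ es) C = (2 ^ length ps - 2) * strong_count V es (insert (u, v) C)"
  using assms(4,5)
proof (induction ps rule: list_nonempty_induct)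
  case (single p)
  obtain a b where ab: "p = (a, b)" by fastforce
  have sub: "linked C \<subseteq> linked (C \<union> set es)" by (rule linked_mono) auto
  have "parallel (C \<union> set es) (a, b) (u, v)"
    using single sub parallel_sym[of C "(u, v)" p] unfolding ab parallel_def by auto
  then have "(a, b) \<notin> linked (C \<union> set es)" using uv parallel_loop by blast
  then show ?case using strong_count_bridge[of a V b C es] single ab by simp
next
  case (cons p ps)
  have par: "parallel C (u, v) p" "\<forall>q\<in>set ps. parallel C (u, v) q" "p \<in> V \<times> V"
    using cons.prems by auto
  obtain q qs where q: "ps = q # qs" using cons.hyps by (cases ps) auto
  have "adjacent_mod (ps @ es) C u v" using par q by (auto simp: adjacent_mod_def)
  then have "strong_count V (p # [] @ ps @ es) C
      = strong_count V ([] @ ps @ es) C + 2 ^ length ([] :: ('a \<times> 'a) list) * strong_count V (ps @ es) (insert (u, v) C)"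
    using par V by (intro strong_count_delete_contract_parallel[of u V v v]) (auto simp: adjacent_mod_def)
  moreover have "strong_count V (ps @ es) (insert (u, v) C) = 2 ^ length ps * strong_count V es (insert (u, v) C)"
    using par(2) parallel_linked_insert by (intro strong_count_loops) blast
  moreover have "(2::nat) ^ length (p # ps) - 2 = (2 ^ length ps - 2) + 2 ^ length ps"
    using q by simp
  ultimately show ?case using cons.IH cons.prems by (simp only: append_Cons add_mult_distrib) simp
qed

lemma tree_count_loops:
  "\<forall>p\<in>set ps. p \<in> linked C \<Longrightarrow> tree_count V (ps @ es) C = tree_count V es C"
  by (induction ps) simp_all

lemma tree_count_parallel:
  assumes "\<forall>p\<in>set ps. parallel C e p" "e \<notin> linked C"
  shows "tree_count V (ps @ es) C = tree_count V es C + length ps * tree_count V es (insert e C)"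
  using assms(1)
proof (induction ps)
  case (Cons p ps)
  have pe: "parallel C p e" using Cons.prems(1) by (simp add: parallel_sym)
  have eq: "linked (insert p C) = linked (insert e C)" using pe by (rule parallel_insert_eq)
  have "p \<notin> linked C" using parallel_loop[OF pe] assms(2) by blast
  moreover have "tree_count V (ps @ es) (insert e C) = tree_count V es (insert e C)"
    using Cons.prems parallel_linked_insert[of C e] by (intro tree_count_loops) simp
  ultimately show ?case using Cons tree_count_cong[OF eq] by simp
qed simp

section \<open>Two apexes joined to independent blocks\<close>

text \<open>
The blocks are the vertices of the minor that still have to be treated. Each is listed with its
elements; the apexes \<open>x\<close> and \<open>y\<close> are outside of all blocks.
\<close>

fun blocks :: "'v rel \<Rightarrow> 'v \<Rightarrow> 'v \<Rightarrow> 'v list list \<Rightarrow> bool" where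
  "blocks C x y [] = True"
| "blocks C x y (K # Ks) \<longleftrightarrow> K \<noteq> [] \<and> set K \<times> set K \<subseteq> linked C \<and>
     (\<forall>a\<in>set K. (a, x) \<notin> linked C \<and> (a, y) \<notin> linked C \<and>
        (\<forall>b\<in>set (concat Ks). (a, b) \<notin> linked C)) \<and> blocks C x y Ks"

text \<open>
The edge between the apexes comes last: then it is still present, and keeps the spokes to \<open>x\<close> of a
block from being a cut, when that block is treated.
\<close>

fun block_spokes :: "'v \<Rightarrow> 'v \<Rightarrow> 'v list list \<Rightarrow> ('v \<times> 'v) list" where
  "block_spokes x y [] = [(x, y)]"
| "block_spokes x y (K # Ks) = map (Pair x) K @ map (Pair y) K @ block_spokes x y Ks"

lemma set_block_spokes: "set (block_spokes x y Ks) = insert (x, y) ({x, y} \<times> set (concat Ks))"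
  by (induction Ks) auto

lemma blocks_avoid:
  "blocks C x y Ks \<Longrightarrow> a \<in> set (concat Ks) \<Longrightarrow> (a, x) \<notin> linked C \<and> (a, y) \<notin> linked C"
  by (induction Ks) auto

lemma blocks_insert:
  assumes "blocks C x y Ks"
    and "\<forall>a\<in>set (concat Ks). (a, p) \<notin> linked C \<and> (a, q) \<notin> linked C"
  shows "blocks (insert (p, q) C) x y Ks"
  using assms
proof (induction Ks)
  case (Cons K Ks)
  have "(a, b) \<in> linked (insert (p, q) C) \<longleftrightarrow> (a, b) \<in> linked C" if "a \<in> set K" for a b
    using that Cons.prems(2) by (simp add: linked_insert)
  moreover have "linked C \<subseteq> linked (insert (p, q) C)" by (rule linked_mono) auto
  ultimately show ?case using Cons by auto
qed simp

context
  fixes C :: "'v rel" and x y :: 'v and K :: "'v list" and Ks :: "'v list list" and k :: 'v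
  assumes bl: "blocks C x y (K # Ks)" and k: "k = hd K"
begin

text \<open>
The element \<open>k\<close> stands for its whole block when the spokes of the block are contracted.
\<close>

lemma hd_block_mem: "k \<in> set K" using bl k by (cases K) auto

lemma hd_block_linked: "a \<in> set K \<Longrightarrow> (k, a) \<in> linked C" using bl hd_block_mem by auto

lemma spokes_x_parallel: "\<forall>p\<in>set (map (Pair x) K). parallel C (x, k) p"
  using hd_block_linked by (auto simp: parallel_def)

lemma spokes_y_parallel: "\<forall>p\<in>set (map (Pair y) K). parallel C (y, k) p"
  using hd_block_linked by (auto simp: parallel_def)

lemma hd_block_not_linked: "(x, k) \<notin> linked C" "(y, k) \<notin> linked C" "(k, x) \<notin> linked C" "(k, y) \<notin> linked C"
  using bl hd_block_mem linked_sym[of x k C] linked_sym[of y k C] by auto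

lemma hd_block_not_linked_later: "b \<in> set (concat Ks) \<Longrightarrow> (k, b) \<notin> linked C \<and> (b, k) \<notin> linked C"
  using bl hd_block_mem linked_sym[of b k C] by auto

lemma blocks_contract_x: "blocks (insert (x, k) C) x y Ks"
  by (rule blocks_insert) (use bl blocks_avoid[of C x y Ks] hd_block_not_linked_later in auto)

lemma blocks_contract_y: "blocks (insert (y, k) C) x y Ks"
  by (rule blocks_insert) (use bl blocks_avoid[of C x y Ks] hd_block_not_linked_later in auto)

lemma hd_block_isolated: "(k, x) \<notin> linked (C \<union> set (block_spokes x y Ks))" "(k, y) \<notin> linked (C \<union> set (block_spokes x y Ks))"
proof -
  have "(k, b) \<in> linked C" if "(k, b) \<in> linked (C \<union> set (block_spokes x y Ks))" for b
    by (rule linked_avoid[OF that]) (use hd_block_not_linked hd_block_not_linked_later in \<open>auto simp: set_block_spokes\<close>)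
  then show "(k, x) \<notin> linked (C \<union> set (block_spokes x y Ks))" "(k, y) \<notin> linked (C \<union> set (block_spokes x y Ks))"
    using hd_block_not_linked by blast+
qed

lemma apexes_joined: "(x, y) \<in> linked (insert (y, k) (insert (x, k) C))"
  by (simp add: linked_insert)

lemma spokes_y_parallel_contracted: "\<forall>p\<in>set (map (Pair y) K). parallel (insert (x, k) C) (y, k) p"
  using hd_block_linked linked_mono[of C "insert (x, k) C"] by (auto simp: parallel_def)

lemma blocks_contract_xy: "blocks (insert (y, k) (insert (x, k) C)) x y Ks"
proof (rule blocks_insert[OF blocks_contract_x], intro ballI)
  fix a assume a: "a \<in> set (concat Ks)"
  then show "(a, y) \<notin> linked (insert (x, k) C) \<and> (a, k) \<notin> linked (insert (x, k) C)"
    using hd_block_not_linked_later[OF a] blocks_avoid[OF blocks_contract_x a]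
      blocks_avoid[of C x y Ks a] bl by (simp add: linked_insert)
qed

end

context
  fixes C :: "'v rel" and x y :: 'v and K :: "'v list" and Ks :: "'v list list" and k :: 'v
  assumes bl: "blocks C x y (K # Ks)" and k: "k = hd K" and xy: "(x, y) \<notin> linked C"
begin

lemma apexes_apart_sym: "(y, x) \<notin> linked C" using xy by (auto dest: linked_sym)

lemma apexes_still_apart: "(x, y) \<notin> linked (insert (x, k) C)" "(x, y) \<notin> linked (insert (y, k) C)"
  using hd_block_not_linked[OF bl k] xy apexes_apart_sym by (auto simp: linked_insert)

lemma y_spoke_not_loop: "(y, k) \<notin> linked (insert (x, k) C)"
  using hd_block_not_linked[OF bl k] xy apexes_apart_sym by (auto simp: linked_insert)

end

text \<open>
Let the apex edge be directed from \<open>x\<close> to \<open>y\<close>. All edges between a block and one apex have the same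
direction, so a block has four patterns, of which only the one with a path from \<open>y\<close> to \<open>x\<close> closes a
cycle.
\<close>

lemma acyclic_count_blocks:
  "blocks C x y Ks \<Longrightarrow> (x, y) \<notin> linked C \<Longrightarrow> acyclic_count (block_spokes x y Ks) C = 2 * 3 ^ length Ks"
proof (induction Ks arbitrary: C)
  case Nil
  have "acyclic_mod C {}" "acyclic_mod (insert (x, y) C) {}" by (auto simp: acyclic_mod_def)
  then show ?case using acyclic_count_delete_contract[OF Nil(2), of "[]"] by (simp add: acyclic_count_def)
next
  case (Cons K Ks)
  define k where k: "k = hd K"
  note bl = Cons.prems(1) and xy = Cons.prems(2)
  let ?B = "block_spokes x y Ks" and ?yK = "map (Pair y) K" and ?xK = "map (Pair x) K"
  have ne: "?xK \<noteq> []" "?yK \<noteq> []" using bl by auto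
  have blK: "blocks C x y Ks" using bl by simp
  have "acyclic_count (?xK @ ?yK @ ?B) C = acyclic_count (?yK @ ?B) C + acyclic_count (?yK @ ?B) (insert (x, k) C)"
    by (rule acyclic_count_parallel[OF ne(1) spokes_x_parallel[OF bl k] hd_block_not_linked(1)[OF bl k]])
  also have "acyclic_count (?yK @ ?B) C = acyclic_count ?B C + acyclic_count ?B (insert (y, k) C)"
    by (rule acyclic_count_parallel[OF ne(2) spokes_y_parallel[OF bl k] hd_block_not_linked(2)[OF bl k]])
  also have "acyclic_count (?yK @ ?B) (insert (x, k) C)
      = acyclic_count ?B (insert (x, k) C) + acyclic_count ?B (insert (y, k) (insert (x, k) C))"
    by (rule acyclic_count_parallel[OF ne(2) spokes_y_parallel_contracted[OF bl k] y_spoke_not_loop[OF bl k xy]])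
  also have "acyclic_count ?B (insert (y, k) (insert (x, k) C)) = 0"
    by (rule acyclic_count_loop[of "(x, y)"]) (use apexes_joined[OF bl k] in \<open>auto simp: set_block_spokes\<close>)
  also have "acyclic_count ?B C = 2 * 3 ^ length Ks" by (rule Cons.IH[OF blK xy])
  also have "acyclic_count ?B (insert (x, k) C) = 2 * 3 ^ length Ks"
    by (rule Cons.IH[OF blocks_contract_x[OF bl k] apexes_still_apart(1)[OF bl k xy]])
  also have "acyclic_count ?B (insert (y, k) C) = 2 * 3 ^ length Ks"
    by (rule Cons.IH[OF blocks_contract_y[OF bl k] apexes_still_apart(2)[OF bl k xy]])
  finally show ?case by simp
qed

text \<open>
Blocks that have been treated are merged with an apex.
\<close>

definition covered_by :: "'v set \<Rightarrow> 'v rel \<Rightarrow> 'v \<Rightarrow> 'v \<Rightarrow> 'v list list \<Rightarrow> bool" where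
  "covered_by V C x y Ks \<longleftrightarrow> {x, y} \<union> set (concat Ks) \<subseteq> V \<and>
     (\<forall>a\<in>V. a \<in> set (concat Ks) \<or> (a, x) \<in> linked C \<or> (a, y) \<in> linked C)"

lemma covered_by_insert:
  assumes "covered_by V C x y (K # Ks)" and "\<forall>a\<in>set K. (k, a) \<in> linked C" and "z = x \<or> z = y"
  shows "covered_by V (insert (z, k) C) x y Ks"
proof -
  have "(a, z) \<in> linked (insert (z, k) C)" if "a \<in> set K" for a
  proof -
    have "(a, k) \<in> linked C" using that assms(2) linked_sym[of k a C] by simp
    then show ?thesis by (simp add: linked_insert)
  qed
  moreover have "linked C \<subseteq> linked (insert (z, k) C)" by (rule linked_mono) auto
  ultimately show ?thesis using assms(1,3) unfolding covered_by_def by auto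
qed

lemma covered_by_more:
  assumes "covered_by V C x y Ks" shows "covered_by V (insert e C) x y Ks"
proof -
  have "linked C \<subseteq> linked (insert e C)" by (rule linked_mono) auto
  then show ?thesis using assms unfolding covered_by_def by blast
qed

lemma covered_by_Nil:
  assumes "covered_by V C x y []" "(x, y) \<in> linked C" shows "V \<times> V \<subseteq> linked C"
proof clarify
  have x: "(a, x) \<in> linked C" if "a \<in> V" for a
  proof -
    have "(a, x) \<in> linked C \<or> (a, y) \<in> linked C" using assms(1) that by (auto simp: covered_by_def)
    then show ?thesis using linked_trans[of a y C x] linked_sym[OF assms(2)] by blast
  qed
  fix a b assume "a \<in> V" "b \<in> V"
  then show "(a, b) \<in> linked C" using linked_trans[OF x linked_sym[OF x]] by blast
qed

text \<open>
With \<open>x\<close> and \<open>y\<close> merged, a block of size $s$ hangs at the apex by $2 s$ parallel edges, which must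
not all have the same direction. The factor 2 is the apex edge, now a loop.
\<close>

lemma strong_count_blocks_joined:
  assumes "blocks C x y Ks" "(x, y) \<in> linked C" "covered_by V C x y Ks"
  shows "int (strong_count V (block_spokes x y Ks) C) = 2 * (\<Prod>K\<leftarrow>Ks. 4 ^ length K - 2)"
  using assms
proof (induction Ks arbitrary: C)
  case Nil
  have "strong V (linked C)"
    using covered_by_Nil[OF Nil(3,2)] by (auto simp: strong_def)
  then show ?case using strong_count_loop[OF Nil(2), of V "[]"] by (simp add: strong_count_def)
next
  case (Cons K Ks)
  define k where k: "k = hd K"
  note bl = Cons.prems(1) and xy = Cons.prems(2)
  let ?B = "block_spokes x y Ks" and ?yK = "map (Pair y) K" and ?xK = "map (Pair x) K"
  have V: "x \<in> V" "y \<in> V" "set K \<subseteq> V" "k \<in> V"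
    using Cons.prems(3) hd_block_mem[OF bl k] by (auto simp: covered_by_def)
  have par: "\<forall>p\<in>set (?xK @ ?yK). parallel C (x, k) p \<and> p \<in> V \<times> V"
    using hd_block_linked[OF bl k] xy V by (auto simp: parallel_def)
  have "(x, k) \<notin> linked (C \<union> set ?B)" using hd_block_isolated(1)[OF bl k] by (auto dest: linked_sym)
  then have "strong_count V ((?xK @ ?yK) @ ?B) C = (2 ^ length (?xK @ ?yK) - 2) * strong_count V ?B (insert (x, k) C)"
    using bl par V by (intro strong_count_bond) auto
  moreover have "int (strong_count V ?B (insert (x, k) C)) = 2 * (\<Prod>K\<leftarrow>Ks. 4 ^ length K - 2)"
  proof (rule Cons.IH[OF blocks_contract_x[OF bl k]])
    show "(x, y) \<in> linked (insert (x, k) C)" using xy by (simp add: linked_insert)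
    show "covered_by V (insert (x, k) C) x y Ks"
      using covered_by_insert[OF Cons.prems(3)] hd_block_linked[OF bl k] by blast
  qed
  moreover have "int (2 ^ length (?xK @ ?yK) - 2) = 4 ^ length K - 2"
  proof -
    have "(2::nat) ^ length (?xK @ ?yK) = 4 ^ length K"
      by (simp add: power_add flip: power_mult_distrib)
    moreover have "(2::nat) \<le> 4 ^ length K"
      using bl self_le_power[of "4::nat" "length K"] by (cases K) auto
    ultimately show ?thesis by (simp add: of_nat_diff)
  qed
  ultimately show ?case by simp
qed

text \<open>
If the apex edge is directed from \<open>x\<close> to \<open>y\<close>, then no block may be a source or a sink, and there must
be a path from \<open>y\<close> to \<open>x\<close>. The first product counts the orientations without sources and sinks, and
the second one those among them without such a path: then a block has no arc from \<open>y\<close>, or no arc to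
\<open>x\<close>, or neither, in $2 (2^s - 1) - 1$ ways.
\<close>

lemma strong_count_blocks:
  assumes "blocks C x y Ks" "(x, y) \<notin> linked C" "covered_by V C x y Ks"
  shows "int (strong_count V (block_spokes x y Ks) C) =
    2 * ((\<Prod>K\<leftarrow>Ks. 4 ^ length K - 2) - (\<Prod>K\<leftarrow>Ks. 2 * 2 ^ length K - 3))"
  using assms
proof (induction Ks arbitrary: C)
  case Nil
  then show ?case using strong_count_bridge[of x V y C "[]"] by (auto simp: covered_by_def)
next
  case (Cons K Ks)
  define k where k: "k = hd K"
  note bl = Cons.prems(1) and xy = Cons.prems(2)
  let ?B = "block_spokes x y Ks" and ?yK = "map (Pair y) K" and ?xK = "map (Pair x) K"
  let ?P = "\<Prod>K\<leftarrow>Ks. 4 ^ length K - 2 :: int" and ?N = "\<Prod>K\<leftarrow>Ks. 2 * 2 ^ length K - 3 :: int"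
  have V: "x \<in> V" "y \<in> V" "set K \<subseteq> V" "k \<in> V"
    using Cons.prems(3) hd_block_mem[OF bl k] by (auto simp: covered_by_def)
  have cov: "covered_by V (insert (x, k) C) x y Ks" "covered_by V (insert (y, k) C) x y Ks"
    using covered_by_insert[OF Cons.prems(3)] hd_block_linked[OF bl k] by blast+
  have ne: "K \<noteq> []" using bl by simp
  have pow: "(2::nat) \<le> 2 ^ length K" using ne self_le_power[of "2::nat" "length K"] by (cases K) auto
  have "strong_count V (?xK @ ?yK @ ?B) C
      = strong_count V (?yK @ ?B) C + (2 ^ length ?xK - 1) * strong_count V (?yK @ ?B) (insert (x, k) C)"
  proof (rule strong_count_parallel[of x V k y])
    \<comment> \<open>The path over \<open>y\<close> shows that the spokes to \<open>x\<close> are no cut.\<close>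
    show "adjacent_mod (?yK @ ?B) C x y"
      by (rule adjacent_mod_edge) (simp add: set_block_spokes)
    show "adjacent_mod (?yK @ ?B) C y k"
      using hd_block_mem[OF bl k] by (intro adjacent_mod_edge) simp
  qed (use V spokes_x_parallel[OF bl k] in auto)
  moreover have "strong_count V (?yK @ ?B) C = (2 ^ length ?yK - 2) * strong_count V ?B (insert (y, k) C)"
  proof (rule strong_count_bond)
    show "(y, k) \<notin> linked (C \<union> set ?B)" using hd_block_isolated(2)[OF bl k] by (auto dest: linked_sym)
  qed (use V spokes_y_parallel[OF bl k] ne in auto)
  moreover have "strong_count V (?yK @ ?B) (insert (x, k) C)
      = strong_count V ?B (insert (x, k) C) + (2 ^ length ?yK - 1) * strong_count V ?B (insert (y, k) (insert (x, k) C))"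
  proof (rule strong_count_parallel[of y V k x])
    have "adjacent_mod ?B (insert (x, k) C) x y"
      by (rule adjacent_mod_edge) (simp add: set_block_spokes)
    then show "adjacent_mod ?B (insert (x, k) C) y x" by (rule adjacent_mod_sym)
    show "adjacent_mod ?B (insert (x, k) C) x k" by (simp add: adjacent_mod_def linked_edge)
  qed (use V spokes_y_parallel_contracted[OF bl k] in auto)
  moreover have "int (strong_count V ?B (insert (y, k) C)) = 2 * (?P - ?N)"
    by (rule Cons.IH[OF blocks_contract_y[OF bl k] apexes_still_apart(2)[OF bl k xy] cov(2)])
  moreover have "int (strong_count V ?B (insert (x, k) C)) = 2 * (?P - ?N)"
    by (rule Cons.IH[OF blocks_contract_x[OF bl k] apexes_still_apart(1)[OF bl k xy] cov(1)])
  moreover have "int (strong_count V ?B (insert (y, k) (insert (x, k) C))) = 2 * ?P"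
    by (rule strong_count_blocks_joined[OF blocks_contract_xy[OF bl k] apexes_joined[OF bl k] covered_by_more[OF cov(1)]])
  ultimately have "int (strong_count V (block_spokes x y (K # Ks)) C) =
      (2 ^ length K - 2) * (2 * (?P - ?N)) +
      (2 ^ length K - 1) * (2 * (?P - ?N) + (2 ^ length K - 1) * (2 * ?P))"
    using pow by (simp add: of_nat_diff)
  moreover have "(4::int) ^ length K = 2 ^ length K * 2 ^ length K"
    by (simp flip: power_mult_distrib)
  ultimately show ?case by (simp add: algebra_simps)
qed

lemma tree_count_blocks_joined:
  assumes "blocks C x y Ks" "(x, y) \<in> linked C" "covered_by V C x y Ks"
  shows "tree_count V (block_spokes x y Ks) C = (\<Prod>K\<leftarrow>Ks. 2 * length K)"
  using assms
proof (induction Ks arbitrary: C)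
  case Nil
  then show ?case using covered_by_Nil[OF Nil(3,2)] by simp
next
  case (Cons K Ks)
  define k where k: "k = hd K"
  note bl = Cons.prems(1) and xy = Cons.prems(2)
  let ?B = "block_spokes x y Ks" and ?yK = "map (Pair y) K" and ?xK = "map (Pair x) K"
  have V: "x \<in> V" "k \<in> V"
    using Cons.prems(3) hd_block_mem[OF bl k] by (auto simp: covered_by_def)
  have par: "\<forall>p\<in>set (?xK @ ?yK). parallel C (x, k) p"
    using hd_block_linked[OF bl k] xy by (auto simp: parallel_def)
  have "tree_count V ((?xK @ ?yK) @ ?B) C
      = tree_count V ?B C + length (?xK @ ?yK) * tree_count V ?B (insert (x, k) C)"
    by (rule tree_count_parallel[OF par hd_block_not_linked(1)[OF bl k]])
  moreover have "tree_count V ?B C = 0"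
    by (rule tree_count_disconnected) (use hd_block_isolated(1)[OF bl k] V in auto)
  moreover have "tree_count V ?B (insert (x, k) C) = (\<Prod>K\<leftarrow>Ks. 2 * length K)"
  proof (rule Cons.IH[OF blocks_contract_x[OF bl k]])
    show "(x, y) \<in> linked (insert (x, k) C)" using xy by (simp add: linked_insert)
    show "covered_by V (insert (x, k) C) x y Ks"
      using covered_by_insert[OF Cons.prems(3)] hd_block_linked[OF bl k] by blast
  qed
  ultimately show ?case by simp
qed

text \<open>
A tree that contains the apex edge attaches each block by one of its $2 s$ edges. A tree without it
attaches exactly one block to both apexes, in $s^2 = 2 s \cdot s / 2$ ways.
\<close>

lemma tree_count_blocks:
  assumes "blocks C x y Ks" "(x, y) \<notin> linked C" "covered_by V C x y Ks"
  shows "2 * tree_count V (block_spokes x y Ks) C = (2 + length (concat Ks)) * (\<Prod>K\<leftarrow>Ks. 2 * length K)"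
  using assms
proof (induction Ks arbitrary: C)
  case Nil
  have "\<not> V \<times> V \<subseteq> linked C" using Nil by (auto simp: covered_by_def)
  moreover have "V \<times> V \<subseteq> linked (insert (x, y) C)"
    by (rule covered_by_Nil[OF covered_by_more[OF Nil(3)]]) (simp add: linked_edge)
  ultimately show ?case using Nil by simp
next
  case (Cons K Ks)
  define k where k: "k = hd K"
  note bl = Cons.prems(1) and xy = Cons.prems(2)
  let ?B = "block_spokes x y Ks" and ?yK = "map (Pair y) K" and ?xK = "map (Pair x) K"
  let ?P = "\<Prod>K\<leftarrow>Ks. 2 * length K"
  have V: "x \<in> V" "k \<in> V"
    using Cons.prems(3) hd_block_mem[OF bl k] by (auto simp: covered_by_def)
  have cov: "covered_by V (insert (x, k) C) x y Ks" "covered_by V (insert (y, k) C) x y Ks"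
    using covered_by_insert[OF Cons.prems(3)] hd_block_linked[OF bl k] by blast+
  have "tree_count V (?xK @ ?yK @ ?B) C
      = tree_count V (?yK @ ?B) C + length ?xK * tree_count V (?yK @ ?B) (insert (x, k) C)"
    by (rule tree_count_parallel[OF spokes_x_parallel[OF bl k] hd_block_not_linked(1)[OF bl k]])
  moreover have "tree_count V (?yK @ ?B) C = tree_count V ?B C + length ?yK * tree_count V ?B (insert (y, k) C)"
    by (rule tree_count_parallel[OF spokes_y_parallel[OF bl k] hd_block_not_linked(2)[OF bl k]])
  moreover have "tree_count V ?B C = 0"
    by (rule tree_count_disconnected) (use hd_block_isolated(1)[OF bl k] V in auto)
  moreover have "tree_count V (?yK @ ?B) (insert (x, k) C)
      = tree_count V ?B (insert (x, k) C) + length ?yK * tree_count V ?B (insert (y, k) (insert (x, k) C))"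
    by (rule tree_count_parallel[OF spokes_y_parallel_contracted[OF bl k] y_spoke_not_loop[OF bl k xy]])
  moreover have "2 * tree_count V ?B (insert (y, k) C) = (2 + length (concat Ks)) * ?P"
    by (rule Cons.IH[OF blocks_contract_y[OF bl k] apexes_still_apart(2)[OF bl k xy] cov(2)])
  moreover have "2 * tree_count V ?B (insert (x, k) C) = (2 + length (concat Ks)) * ?P"
    by (rule Cons.IH[OF blocks_contract_x[OF bl k] apexes_still_apart(1)[OF bl k xy] cov(1)])
  moreover have "tree_count V ?B (insert (y, k) (insert (x, k) C)) = ?P"
    by (rule tree_count_blocks_joined[OF blocks_contract_xy[OF bl k] apexes_joined[OF bl k] covered_by_more[OF cov(1)]])
  ultimately have "2 * tree_count V (block_spokes x y (K # Ks)) C =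
     length K * ((2 + length (concat Ks)) * ?P) +
     length K * ((2 + length (concat Ks)) * ?P + length K * (2 * ?P))"
    by (simp add: algebra_simps)
  then show ?case by (simp add: algebra_simps)
qed

section \<open>The inequality for independent blocks\<close>

text \<open>
Equality holds for $s = 1$. From $s = 2$ on, passing to $s + 1$ multiplies the left side by at most
$\frac32 (\frac32)^2 < 4$, and the right side by at least 4.
\<close>

lemma block_ineq:
  assumes "s \<ge> (1::nat)"
  shows "(3 / 2) ^ s * (2 * real s)\<^sup>2 \<le> 3 * (4 ^ s - 2)"
  using assms
proof (induction s rule: nat_induct_at_least)
  case (Suc s)
  show ?case
  proof (cases "s = 1")
    case True
    then show ?thesis by (simp add: power2_eq_square)
  next
    case False
    then have s: "real s \<ge> 2" using Suc.hyps by simp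
    have "(3 / 2) ^ Suc s * (2 * real (Suc s))\<^sup>2 = (3 / 2) ^ s * (6 * (real s + 1)\<^sup>2)"
      by (simp add: power2_eq_square algebra_simps)
    also have "\<dots> \<le> (3 / 2) ^ s * (4 * (2 * real s)\<^sup>2)"
    proof (rule mult_left_mono)
      have "0 \<le> (real s - 2) * (10 * real s + 8)" using s by (intro mult_nonneg_nonneg) auto
      then show "6 * (real s + 1)\<^sup>2 \<le> 4 * (2 * real s)\<^sup>2"
        by (simp add: power2_eq_square algebra_simps)
    qed simp
    also have "\<dots> = 4 * ((3 / 2) ^ s * (2 * real s)\<^sup>2)" by simp
    also have "\<dots> \<le> 4 * (3 * (4 ^ s - 2))" using Suc.IH by simp
    also have "\<dots> \<le> 3 * (4 ^ Suc s - 2)" by simp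
    finally show ?thesis .
  qed
qed simp

text \<open>
Equality holds for $s = 2$. In each step the left side grows by a factor less than 4, and the right
side by a factor of at least 4.
\<close>

lemma single_block_ineq:
  assumes "s \<ge> (2::nat)"
  shows "(3 / 2) ^ s * (real s)\<^sup>2 \<le> (2 ^ s - 1)\<^sup>2"
  using assms
proof (induction s rule: nat_induct_at_least)
  case (Suc s)
  have s: "real s \<ge> 2" using Suc.hyps by simp
  have "(3 / 2) ^ Suc s * (real (Suc s))\<^sup>2 = (3 / 2) ^ s * (3 / 2 * (real s + 1)\<^sup>2)"
    by (simp add: algebra_simps)
  also have "\<dots> \<le> (3 / 2) ^ s * (4 * (real s)\<^sup>2)"
  proof (rule mult_left_mono)
    have "0 \<le> (real s - 2) * (5 * real s + 4)" using s by (intro mult_nonneg_nonneg) auto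
    then show "3 / 2 * (real s + 1)\<^sup>2 \<le> 4 * (real s)\<^sup>2"
      by (simp add: power2_eq_square algebra_simps)
  qed simp
  also have "\<dots> = 4 * ((3 / 2) ^ s * (real s)\<^sup>2)" by simp
  also have "\<dots> \<le> 4 * (2 ^ s - 1)\<^sup>2" using Suc.IH by simp
  also have "\<dots> = (2 * (2 ^ s - 1 :: real))\<^sup>2" by (simp only: power_mult_distrib) simp
  also have "\<dots> \<le> (2 ^ Suc s - 1)\<^sup>2"
  proof (rule power_mono)
    show "0 \<le> 2 * (2 ^ s - 1 :: real)" by simp
  qed simp
  finally show ?case .
qed (simp add: power2_eq_square)

lemma blocks_product_ineq:
  assumes "\<forall>s\<in>set ss. s \<ge> (1::nat)"
  shows "(3 / 2) ^ sum_list ss * (\<Prod>s\<leftarrow>ss. 2 * real s)\<^sup>2 \<le> 3 ^ length ss * (\<Prod>s\<leftarrow>ss. 4 ^ s - 2)"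
  using assms
proof (induction ss)
  case (Cons s ss)
  have "(3 / 2) ^ sum_list (s # ss) * (\<Prod>s\<leftarrow>s # ss. 2 * real s)\<^sup>2 =
      ((3 / 2) ^ s * (2 * real s)\<^sup>2) * ((3 / 2) ^ sum_list ss * (\<Prod>s\<leftarrow>ss. 2 * real s)\<^sup>2)"
    by (simp add: power_add power_mult_distrib)
  also have "\<dots> \<le> (3 * (4 ^ s - 2)) * (3 ^ length ss * (\<Prod>s\<leftarrow>ss. 4 ^ s - 2))"
  proof (rule mult_mono)
    show "(3 / 2) ^ s * (2 * real s)\<^sup>2 \<le> 3 * (4 ^ s - 2)" using Cons.prems by (intro block_ineq) auto
    show "0 \<le> (3::real) * (4 ^ s - 2)" using Cons.prems self_le_power[of "4::real" s] by simp
  qed (use Cons in auto)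
  finally show ?case by (simp only: length_Cons power_Suc list.map prod_list.Cons mult_ac)
qed simp

text \<open>
For one block this is $0 \le (2^s - 2)^2$.
\<close>

lemma one_way_ineq:
  assumes "\<forall>s\<in>set ss. s \<ge> (1::nat)"
  shows "0 \<le> (\<Prod>s\<leftarrow>ss. 2 * 2 ^ s - 3 :: real) \<and>
    2 ^ length ss * (\<Prod>s\<leftarrow>ss. 2 * 2 ^ s - 3) \<le> (\<Prod>s\<leftarrow>ss. 4 ^ s - 2 :: real)"
  using assms
proof (induction ss)
  case (Cons s ss)
  have s: "2 \<le> (2::real) ^ s" using Cons.prems self_le_power[of "2::real" s] by simp
  have "(4::real) ^ s = 2 ^ s * 2 ^ s" by (simp flip: power_mult_distrib)
  moreover have "0 \<le> (2 ^ s - 2 :: real)\<^sup>2" by simp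
  ultimately have 1: "2 * (2 * 2 ^ s - 3) \<le> (4 ^ s - 2 :: real)"
    by (simp add: power2_eq_square algebra_simps)
  have ih: "0 \<le> (\<Prod>s\<leftarrow>ss. 2 * 2 ^ s - 3 :: real)"
    "2 ^ length ss * (\<Prod>s\<leftarrow>ss. 2 * 2 ^ s - 3) \<le> (\<Prod>s\<leftarrow>ss. 4 ^ s - 2 :: real)"
    using Cons by auto
  have "(2 * (2 * 2 ^ s - 3)) * (2 ^ length ss * (\<Prod>s\<leftarrow>ss. 2 * 2 ^ s - 3 :: real))
     \<le> (4 ^ s - 2) * (\<Prod>s\<leftarrow>ss. 4 ^ s - 2)"
    using 1 s ih by (intro mult_mono) auto
  then have "2 ^ length (s # ss) * (\<Prod>s\<leftarrow>s # ss. 2 * 2 ^ s - 3) \<le> (\<Prod>s\<leftarrow>s # ss. 4 ^ s - 2 :: real)"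
    by (simp only: length_Cons power_Suc list.map prod_list.Cons mult_ac)
  then show ?case using s ih by simp
qed simp

text \<open>
For at least two blocks the product of the $2^{s + 1} - 3$ is at most a quarter of the product of the
$4^s - 2$, and the rest is a product of inequalities for single blocks. For one block of size $s$ the
difference is $4^s - 2^{s+1} + 1 = (2^s - 1)^2$, which is estimated directly.
\<close>

lemma blocks_ineq:
  fixes ss :: "nat list"
  assumes ss: "\<forall>s\<in>set ss. s \<ge> (1::nat)" and sum: "sum_list ss \<ge> 2"
  shows "3 * (3 / 2) ^ sum_list ss * (\<Prod>s\<leftarrow>ss. 2 * real s)\<^sup>2
    \<le> 4 * 3 ^ length ss * ((\<Prod>s\<leftarrow>ss. 4 ^ s - 2) - (\<Prod>s\<leftarrow>ss. 2 * 2 ^ s - 3))"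
proof (cases "length ss \<ge> 2")
  case True
  let ?P = "\<Prod>s\<leftarrow>ss. 4 ^ s - 2 :: real" and ?N = "\<Prod>s\<leftarrow>ss. 2 * 2 ^ s - 3 :: real"
  have N: "0 \<le> ?N" "2 ^ length ss * ?N \<le> ?P" using one_way_ineq[OF ss] by auto
  have "(4::real) \<le> 2 ^ length ss" using power_increasing[OF True, of "2::real"] by simp
  then have "4 * ?N \<le> ?P" using N mult_right_mono[of 4 "2 ^ length ss" ?N] by linarith
  then have "3 ^ length ss * (3 * ?P) \<le> 3 ^ length ss * (4 * (?P - ?N))"
    by (intro mult_left_mono) auto
  moreover have "3 * (3 / 2) ^ sum_list ss * (\<Prod>s\<leftarrow>ss. 2 * real s)\<^sup>2 \<le> 3 ^ length ss * (3 * ?P)"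
    using blocks_product_ineq[OF ss] by linarith
  ultimately show ?thesis by (simp only: mult_ac)
next
  case False
  then obtain s where s: "ss = [s]" using sum by (cases ss; cases "tl ss") auto
  have "(4::real) ^ s = 2 ^ s * 2 ^ s" by (simp flip: power_mult_distrib)
  then show ?thesis using single_block_ineq[of s] sum s
    by (simp add: power2_eq_square algebra_simps)
qed

section \<open>The inequality for one parallel class\<close>

text \<open>
The number $\frac{17}{10}$ is a lower bound for $\sqrt 3$, and $\frac{27}{10} = \frac{17}{10} + 1$.
There is little room for a cruder bound: at $p = 2$ the first estimate reads $8 \le 8.1$.
\<close>

lemma parallel_class_ineq: "p \<ge> 2 \<Longrightarrow> real p * (real p + 2) \<le> 27 / 10 * (2 ^ p - 1) \<and> 2 * real p \<le> 17 / 10 * (2 ^ p - 1)"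
proof (induction p rule: nat_induct_at_least)
  case (Suc p)
  have p: "real p \<ge> 2" using Suc.hyps by simp
  have "0 \<le> (real p - 2) * (real p + 2)" using p by (intro mult_nonneg_nonneg) auto
  then show ?case using Suc.IH p by (simp add: algebra_simps)
qed simp

text \<open>
The product on the right has the cross terms $(2^p - 1) X + Y$ with $X = A_0 B_1$ and $Y = A_1 B_0$,
where $X Y \ge m^2$ for $m = c\, T_0 T_1$. For $p = 1$ this gives $X + Y \ge 2 m$ as needed. For
$p \ge 2$ the relation $X \ge 3 Y$ gives $X \ge \sqrt 3\, m$. The surplus over $2 p m$ then pays for
the deficit of $2^p - 1$ against $p^2$ in the coefficient of $c\, T_1^2$, because $T_1 \le T_0$.
\<close>

lemma step_ineq:
  fixes A0 A1 B0 B1 T0 T1 c :: real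
  assumes h0: "c * T0\<^sup>2 \<le> A0 * B0" and h1: "c * T1\<^sup>2 \<le> A1 * B1"
    and A: "0 \<le> A1" "3 * A1 \<le> A0" and B: "0 \<le> B0" "B0 \<le> B1" and T: "0 \<le> T1" "T1 \<le> T0"
    and c: "0 \<le> c" and p: "p \<ge> (1::nat)"
  shows "c * (T0 + real p * T1)\<^sup>2 \<le> (A0 + A1) * (B0 + (2 ^ p - 1) * B1)"
proof -
  define m X Y where "m = c * (T0 * T1)" and "X = A0 * B1" and "Y = A1 * B0"
  have mT: "c * T1\<^sup>2 \<le> m"
    unfolding m_def power2_eq_square using c T by (intro mult_left_mono mult_right_mono)
  have XY0: "0 \<le> X" "0 \<le> Y" using A B by (auto simp: X_def Y_def)
  have "3 * A1 * B0 \<le> A0 * B1" using A B by (intro mult_mono) auto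
  then have XY: "3 * Y \<le> X" by (simp add: X_def Y_def)
  have "m\<^sup>2 = (c * T0\<^sup>2) * (c * T1\<^sup>2)" by (simp add: m_def power2_eq_square)
  also have "\<dots> \<le> (A0 * B0) * (A1 * B1)" using A B c by (intro mult_mono[OF h0 h1]) auto
  finally have m2: "m\<^sup>2 \<le> X * Y" by (simp add: X_def Y_def mult_ac)
  have L: "c * (T0 + real p * T1)\<^sup>2 = c * T0\<^sup>2 + 2 * real p * m + (real p)\<^sup>2 * (c * T1\<^sup>2)"
    by (simp add: m_def power2_eq_square algebra_simps)
  have R: "(A0 + A1) * (B0 + (2 ^ p - 1) * B1) =
      A0 * B0 + (2 ^ p - 1) * (A1 * B1) + ((2 ^ p - 1) * X + Y)"
    by (simp add: X_def Y_def algebra_simps)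
  show ?thesis
  proof (cases "p = 1")
    case True
    have "(X + Y)\<^sup>2 = (X - Y)\<^sup>2 + 4 * (X * Y)" by (simp add: power2_eq_square algebra_simps)
    moreover have "(2 * m)\<^sup>2 = 4 * m\<^sup>2" by (simp add: power_mult_distrib)
    ultimately have "(2 * m)\<^sup>2 \<le> (X + Y)\<^sup>2"
      using m2 zero_le_power2[of "X - Y"] by linarith
    then have "2 * m \<le> X + Y" by (rule power2_le_imp_le) (use XY0 in simp)
    then show ?thesis using L R h0 h1 True by simp
  next
    case False
    then have p2: "p \<ge> 2" using p by simp
    define b :: real where "b = 2 ^ p - 1"
    have b: "real p * (real p + 2) \<le> 27 / 10 * b" "2 * real p \<le> 17 / 10 * b"
      using parallel_class_ineq[OF p2] by (auto simp: b_def)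
    have b0: "0 \<le> b" by (simp add: b_def)
    have "3 * m\<^sup>2 \<le> X * (3 * Y)" using m2 by simp
    also have "\<dots> \<le> X * X" using XY XY0 by (intro mult_left_mono)
    finally have "3 * m\<^sup>2 \<le> X\<^sup>2" by (simp only: power2_eq_square)
    moreover have "(17 / 10 * m)\<^sup>2 = 289 / 100 * m\<^sup>2" by (simp add: power_mult_distrib power2_eq_square)
    ultimately have "(17 / 10 * m)\<^sup>2 \<le> X\<^sup>2"
      using zero_le_power2[of m] by linarith
    then have "17 / 10 * m \<le> X" by (rule power2_le_imp_le) (use XY0 in simp)
    then have 1: "b * (17 / 10 * m) \<le> b * X" using b0 by (intro mult_left_mono)
    have 2: "b * (c * T1\<^sup>2) \<le> b * (A1 * B1)" using h1 b0 by (intro mult_left_mono)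
    define t where "t = c * T1\<^sup>2"
    have "0 \<le> (17 / 10 * b - 2 * real p) * (m - t)"
      using b mT by (intro mult_nonneg_nonneg) (auto simp: t_def)
    moreover have "0 \<le> (27 / 10 * b - real p * (real p + 2)) * t"
      using b c by (intro mult_nonneg_nonneg) (auto simp: t_def)
    moreover have "(17 / 10 * b - 2 * real p) * (m - t) + (27 / 10 * b - real p * (real p + 2)) * t
        = b * t + b * (17 / 10 * m) - (2 * real p * m + (real p)\<^sup>2 * t)"
      by (simp add: power2_eq_square algebra_simps add_divide_distrib diff_divide_distrib)
    ultimately have "2 * real p * m + (real p)\<^sup>2 * t \<le> b * t + b * (17 / 10 * m)"
      by linarith
    then have "c * T0\<^sup>2 + 2 * real p * m + (real p)\<^sup>2 * t \<le> A0 * B0 + b * (A1 * B1) + (b * X + Y)"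
      using 1 2 h0 XY0 unfolding t_def[symmetric] by linarith
    then show ?thesis unfolding L R b_def t_def .
  qed
qed

section \<open>Induction over the edges that avoid the apexes\<close>

text \<open>
The edges of $G$ outside of $F$, where \<open>ws\<close> lists the vertices of $F$.
\<close>

definition double_cone :: "'v \<Rightarrow> 'v \<Rightarrow> 'v list \<Rightarrow> ('v \<times> 'v) list" where
  "double_cone x y ws = map (Pair x) ws @ map (Pair y) ws @ [(x, y)]"

text \<open>
This stays true when edges of $F$ are contracted.
\<close>

definition apart :: "'v rel \<Rightarrow> 'v \<Rightarrow> 'v \<Rightarrow> 'v set \<Rightarrow> bool" where
  "apart C x y W \<longleftrightarrow> (x, y) \<notin> linked C \<and>
     (\<forall>a\<in>W. (a, x) \<notin> linked C \<and> (a, y) \<notin> linked C)"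

lemma apart_insert:
  assumes "apart C x y W" "e \<in> W \<times> W" shows "apart (insert e C) x y W"
proof -
  obtain u v where e: "e = (u, v)" "u \<in> W" "v \<in> W" using assms(2) by auto
  have "(x, u) \<notin> linked C" "(x, v) \<notin> linked C"
    using assms(1) e linked_sym[of x u C] linked_sym[of x v C] unfolding apart_def by auto
  then show ?thesis using assms(1) e by (auto simp: apart_def linked_insert)
qed

lemma mset_block_spokes: "mset (block_spokes x y Ks) = mset (double_cone x y (concat Ks))"
  by (induction Ks) (auto simp: double_cone_def)

lemma double_cone_perm: "mset ws = mset ws' \<Longrightarrow> mset (double_cone x y ws) = mset (double_cone x y ws')"
  by (simp add: double_cone_def)

lemma blocks_exist:
  assumes "\<forall>a\<in>set ws. (a, x) \<notin> linked C \<and> (a, y) \<notin> linked C"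
  obtains Ks where "blocks C x y Ks" "mset (concat Ks) = mset ws"
  using assms
proof (induction "length ws" arbitrary: ws thesis rule: less_induct)
  case less
  show ?case
  proof (cases ws)
    case Nil
    then show ?thesis using less.prems(1)[of "[]"] by simp
  next
    case (Cons v ws')
    let ?rest = "filter (\<lambda>a. (v, a) \<notin> linked C) ws'"
    let ?K = "v # filter (\<lambda>a. (v, a) \<in> linked C) ws'"
    have "length ?rest < length ws" using Cons by (simp add: le_imp_less_Suc)
    then obtain Ks where Ks: "blocks C x y Ks" "mset (concat Ks) = mset ?rest"
      using less.hyps[of ?rest] less.prems(2) Cons by auto
    have set: "set (concat Ks) = set ?rest" using Ks(2) by (rule mset_eq_setD)
    have K: "(v, a) \<in> linked C" if "a \<in> set ?K" for a using that by auto
    have "(a, b) \<in> linked C" if "a \<in> set ?K" "b \<in> set ?K" for a b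
      using linked_trans[OF linked_sym[OF K[OF that(1)]] K[OF that(2)]] .
    moreover have "(a, b) \<notin> linked C" if "a \<in> set ?K" "b \<in> set (concat Ks)" for a b
    proof
      assume "(a, b) \<in> linked C"
      then have "(v, b) \<in> linked C" by (rule linked_trans[OF K[OF that(1)]])
      then show False using that(2) unfolding set by simp
    qed
    moreover have "set ?K \<subseteq> set ws" "?K \<noteq> []" using Cons by auto
    ultimately have "blocks C x y (?K # Ks)"
      unfolding blocks.simps using Ks(1) less.prems(2) by blast
    moreover have "mset (concat (?K # Ks)) = mset ws" using Ks(2) Cons by simp
    ultimately show ?thesis using less.prems(1) by blast
  qed
qed

text \<open>
Contracting \<open>uv\<close> merges the blocks of its ends, here put in front, and leaves the others as they are.
\<close>

lemma blocks_exist_two: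
  assumes ap: "\<forall>a\<in>set ws. (a, x) \<notin> linked C \<and> (a, y) \<notin> linked C"
    and uv: "u \<in> set ws" "v \<in> set ws" "(u, v) \<notin> linked C"
  obtains K L Ks where "blocks C x y (K # L # Ks)" "blocks (insert (u, v) C) x y ((K @ L) # Ks)"
    "mset (concat (K # L # Ks)) = mset ws"
proof -
  define K where "K = filter (\<lambda>a. (u, a) \<in> linked C) ws"
  define L where "L = filter (\<lambda>a. (v, a) \<in> linked C) ws"
  define rest where "rest = filter (\<lambda>a. (u, a) \<notin> linked C \<and> (v, a) \<notin> linked C) ws"
  have K: "a \<in> set K \<longleftrightarrow> a \<in> set ws \<and> (u, a) \<in> linked C" for a by (auto simp: K_def)
  have L: "a \<in> set L \<longleftrightarrow> a \<in> set ws \<and> (v, a) \<in> linked C" for a by (auto simp: L_def)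
  obtain Ks where Ks: "blocks C x y Ks" "mset (concat Ks) = mset rest"
    using blocks_exist[of rest x C y] ap by (auto simp: rest_def)
  have later: "(u, b) \<notin> linked C" "(v, b) \<notin> linked C" if "b \<in> set (concat Ks)" for b
    using that mset_eq_setD[OF Ks(2)] by (auto simp: rest_def)
  have uv_disj: "(u, a) \<notin> linked C \<or> (v, a) \<notin> linked C" for a
    using uv(3) linked_trans[of u a C v] linked_sym[of v a C] by argo
  have far: "(a, z) \<notin> linked C"
    if "(w, a) \<in> linked C" "(w, z) \<notin> linked C" for w a z
    using that linked_trans[of w a C z] by argo
  have "u \<in> set K" "v \<in> set L" using uv by (auto simp: K L)
  then have ne: "K \<noteq> []" "L \<noteq> []" by auto
  have 1: "blocks C x y (K # L # Ks)"
    unfolding blocks.simps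
  proof (intro conjI ballI subrelI Ks(1))
    fix a b assume "(a, b) \<in> set K \<times> set K"
    then show "(a, b) \<in> linked C" using linked_trans[OF linked_sym[of u a C], of b] by (simp add: K)
  next
    fix a b assume "(a, b) \<in> set L \<times> set L"
    then show "(a, b) \<in> linked C" using linked_trans[OF linked_sym[of v a C], of b] by (simp add: L)
  next
    fix a b assume "a \<in> set K" "b \<in> set (concat (L # Ks))"
    then show "(a, b) \<notin> linked C"
      using far[of u a b] uv_disj[of b] later(1)[of b] K L by auto
  next
    fix a b assume "a \<in> set L" "b \<in> set (concat Ks)"
    then show "(a, b) \<notin> linked C" using far[of v a b] later(2)[of b] L by simp
  qed (use ne ap K L in auto)
  let ?C = "insert (u, v) C"
  have u: "(u, a) \<in> linked ?C" if "a \<in> set (K @ L)" for a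
    using that by (auto simp: linked_insert K L)
  have blKs: "blocks ?C x y Ks"
    by (rule blocks_insert[OF Ks(1)]) (use later linked_sym[of _ u C] linked_sym[of _ v C] in blast)
  have far': "(a, z) \<notin> linked ?C"
    if "a \<in> set (K @ L)" "(u, z) \<notin> linked C" "(v, z) \<notin> linked C" for a z
  proof -
    have "(u, a) \<in> linked C \<or> (v, a) \<in> linked C" using that(1) by (auto simp: K L)
    then have "(a, z) \<notin> linked C" using that(2,3) far by blast
    then show ?thesis using that(2,3) by (simp add: linked_insert)
  qed
  have 2: "blocks ?C x y ((K @ L) # Ks)"
    unfolding blocks.simps
  proof (intro conjI ballI subrelI blKs)
    fix a b assume "(a, b) \<in> set (K @ L) \<times> set (K @ L)"
    then show "(a, b) \<in> linked ?C" using linked_trans[OF linked_sym[OF u[of a]] u[of b]] by blast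
  next
    fix a assume "a \<in> set (K @ L)"
    then show "(a, x) \<notin> linked ?C" by (rule far') (use ap uv in auto)
  next
    fix a assume "a \<in> set (K @ L)"
    then show "(a, y) \<notin> linked ?C" by (rule far') (use ap uv in auto)
  next
    fix a b assume "a \<in> set (K @ L)" "b \<in> set (concat Ks)"
    then show "(a, b) \<notin> linked ?C" using far'[of a b] later[of b] by simp
  qed (use ne in auto)
  have "mset ws = mset K + mset (filter (\<lambda>a. (u, a) \<notin> linked C) ws)"
    using multiset_partition[of "mset ws" "\<lambda>a. (u, a) \<in> linked C"] by (simp add: K_def)
  also have "mset (filter (\<lambda>a. (u, a) \<notin> linked C) ws) = mset L + mset rest"
  proof -
    have "filter (\<lambda>a. (u, a) \<notin> linked C \<and> (v, a) \<in> linked C) ws = L"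
      unfolding L_def using uv_disj by (intro filter_cong) auto
    moreover have "mset (filter (\<lambda>a. (u, a) \<notin> linked C) ws) =
       mset (filter (\<lambda>a. (u, a) \<notin> linked C \<and> (v, a) \<in> linked C) ws) + mset rest"
      unfolding rest_def by (induction ws) auto
    ultimately show ?thesis by simp
  qed
  finally have 3: "mset (concat (K # L # Ks)) = mset ws" using Ks(2) by simp
  show ?thesis by (rule that[OF 1 2 3])
qed

lemma acyclic_count_double_cone:
  assumes "blocks C x y Ks" "mset (concat Ks) = mset ws" "(x, y) \<notin> linked C"
  shows "acyclic_count (double_cone x y ws) C = 2 * 3 ^ length Ks"
  using acyclic_count_blocks[OF assms(1,3)] acyclic_count_perm[of "block_spokes x y Ks" "double_cone x y ws"] double_cone_perm[OF assms(2)]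
  by (simp add: mset_block_spokes)

lemma covered_by_all:
  assumes "mset (concat Ks) = mset ws" shows "covered_by ({x, y} \<union> set ws) C x y Ks"
  using mset_eq_setD[OF assms] by (auto simp: covered_by_def)

lemma strong_count_double_cone:
  assumes "blocks C x y Ks" "mset (concat Ks) = mset ws" "(x, y) \<notin> linked C"
  shows "int (strong_count ({x, y} \<union> set ws) (double_cone x y ws) C) =
    2 * ((\<Prod>K\<leftarrow>Ks. 4 ^ length K - 2) - (\<Prod>K\<leftarrow>Ks. 2 * 2 ^ length K - 3))"
  using strong_count_blocks[OF assms(1,3) covered_by_all[OF assms(2)]] strong_count_perm[of "block_spokes x y Ks" "double_cone x y ws"]
    double_cone_perm[OF assms(2)]
  by (simp add: mset_block_spokes)

lemma tree_count_double_cone: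
  assumes "blocks C x y Ks" "mset (concat Ks) = mset ws" "(x, y) \<notin> linked C"
  shows "2 * tree_count ({x, y} \<union> set ws) (double_cone x y ws) C = (2 + length ws) * (\<Prod>K\<leftarrow>Ks. 2 * length K)"
  using tree_count_blocks[OF assms(1,3) covered_by_all[OF assms(2)]] tree_count_perm[of "block_spokes x y Ks" "double_cone x y ws"]
    double_cone_perm[OF assms(2)] mset_eq_length[OF assms(2)]
  by (simp add: mset_block_spokes)

lemma insert_loop_iff:
  "(u, v) \<in> linked (insert e C) \<and> (u, v) \<notin> linked C \<Longrightarrow> e \<in> linked (insert (u, v) C)"
  using linked_insert_iff[of "(u, v)" e C] parallel_linked_insert[of C "(u, v)" e] by blast

text \<open>
The list \<open>es\<close> may still contain edges parallel to \<open>uv\<close>. Deletion and contraction of its first edge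
commute with the contraction of \<open>uv\<close>, so the claim passes from both minors to the whole graph; an
edge that becomes a loop by contracting \<open>uv\<close> makes the left side 0. Without such edges, contracting
\<open>uv\<close> lowers the number of blocks by one.
\<close>

lemma acyclic_count_contract_le:
  assumes "apart C x y (set ws)" "u \<in> set ws" "v \<in> set ws" "(u, v) \<notin> linked C"
    "set es \<subseteq> set ws \<times> set ws"
  shows "3 * acyclic_count (es @ double_cone x y ws) (insert (u, v) C) \<le> acyclic_count (es @ double_cone x y ws) C"
  using assms
proof (induction es arbitrary: C)
  case Nil
  have ap: "\<forall>a\<in>set ws. (a, x) \<notin> linked C \<and> (a, y) \<notin> linked C" "(x, y) \<notin> linked C"
    using Nil(1) by (auto simp: apart_def)
  have xy: "(x, y) \<notin> linked (insert (u, v) C)"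
    using apart_insert[OF Nil(1), of "(u, v)"] Nil(2,3) by (auto simp: apart_def)
  obtain K L Ks where bl: "blocks C x y (K # L # Ks)" "blocks (insert (u, v) C) x y ((K @ L) # Ks)"
    "mset (concat (K # L # Ks)) = mset ws"
    using blocks_exist_two[OF ap(1) Nil(2-4)] by blast
  have m: "mset (concat ((K @ L) # Ks)) = mset ws" using bl(3) by simp
  show ?case using acyclic_count_double_cone[OF bl(1,3) ap(2)] acyclic_count_double_cone[OF bl(2) m xy] by simp
next
  case (Cons e es)
  show ?case
  proof (cases "e \<in> linked (insert (u, v) C)")
    case True
    then have "acyclic_count ((e # es) @ double_cone x y ws) (insert (u, v) C) = 0" by (intro acyclic_count_loop[of e]) auto
    then show ?thesis by simp
  next
    case False
    then have eC: "e \<notin> linked C" by (simp add: linked_insert_iff)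
    have uv: "(u, v) \<notin> linked (insert e C)"
      using insert_loop_iff[of u v e C] Cons.prems(4) False by blast
    have "acyclic_count (e # es @ double_cone x y ws) (insert (u, v) C) = acyclic_count (es @ double_cone x y ws) (insert (u, v) C)
        + acyclic_count (es @ double_cone x y ws) (insert (u, v) (insert e C))"
      using False acyclic_count_delete_contract[of "fst e" "snd e"] by (simp add: insert_commute)
    moreover have "acyclic_count (e # es @ double_cone x y ws) C = acyclic_count (es @ double_cone x y ws) C
        + acyclic_count (es @ double_cone x y ws) (insert e C)"
      using eC acyclic_count_delete_contract[of "fst e" "snd e"] by simp
    moreover have "3 * acyclic_count (es @ double_cone x y ws) (insert (u, v) C) \<le> acyclic_count (es @ double_cone x y ws) C"
      using Cons by simp
    moreover have "3 * acyclic_count (es @ double_cone x y ws) (insert (u, v) (insert e C)) \<le> acyclic_count (es @ double_cone x y ws) (insert e C)"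
      using Cons.IH[OF apart_insert[OF Cons.prems(1)] Cons.prems(2,3) uv] Cons.prems(5) by simp
    ultimately show ?thesis by simp
  qed
qed

text \<open>
In terms of electrical networks, the effective resistance between \<open>u\<close> and \<open>v\<close> is at most 1, because
the paths over \<open>x\<close> and over \<open>y\<close> have resistance at most 2 each. The induction is the same as for
\<open>acyclic_count_contract_le\<close>. Without further edges, two blocks of sizes $s$, $t$ are merged, and
$2 (s + t) \le 2 s \cdot 2 t$.
\<close>

lemma tree_count_contract_le:
  assumes "apart C x y (set ws)" "u \<in> set ws" "v \<in> set ws" "(u, v) \<notin> linked C"
    "set es \<subseteq> set ws \<times> set ws" and V: "V = {x, y} \<union> set ws"
  shows "tree_count V (es @ double_cone x y ws) (insert (u, v) C) \<le> tree_count V (es @ double_cone x y ws) C"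
  using assms(1-5)
proof (induction es arbitrary: C)
  case Nil
  have ap: "\<forall>a\<in>set ws. (a, x) \<notin> linked C \<and> (a, y) \<notin> linked C" "(x, y) \<notin> linked C"
    using Nil(1) by (auto simp: apart_def)
  have xy: "(x, y) \<notin> linked (insert (u, v) C)"
    using apart_insert[OF Nil(1), of "(u, v)"] Nil(2,3) by (auto simp: apart_def)
  obtain K L Ks where bl: "blocks C x y (K # L # Ks)" "blocks (insert (u, v) C) x y ((K @ L) # Ks)"
    "mset (concat (K # L # Ks)) = mset ws"
    using blocks_exist_two[OF ap(1) Nil(2-4)] by blast
  have m: "mset (concat ((K @ L) # Ks)) = mset ws" using bl(3) by simp
  have "1 \<le> length K" "1 \<le> length L" using bl(1) by (auto simp: Suc_le_eq)
  then obtain k l where kl: "length K = Suc k" "length L = Suc l" by (metis Suc_le_D One_nat_def)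
  let ?P = "\<Prod>K\<leftarrow>Ks. 2 * length K"
  have "2 * tree_count V (double_cone x y ws) (insert (u, v) C) = (2 + length ws) * ((2 * (length K + length L)) * ?P)"
    using tree_count_double_cone[OF bl(2) m xy] V by simp
  also have "\<dots> \<le> (2 + length ws) * ((2 * length K * (2 * length L)) * ?P)"
    unfolding kl by (intro mult_le_mono2 mult_le_mono1) (simp add: algebra_simps)
  also have "\<dots> = 2 * tree_count V (double_cone x y ws) C"
    using tree_count_double_cone[OF bl(1,3) ap(2)] V by (simp add: mult.assoc)
  finally show ?case by simp
next
  case (Cons e es)
  let ?E = "es @ double_cone x y ws"
  have IH: "tree_count V ?E (insert (u, v) C) \<le> tree_count V ?E C" using Cons by simp
  show ?case
  proof (cases "e \<in> linked (insert (u, v) C)")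
    case True
    then show ?thesis using IH by simp
  next
    case False
    then have eC: "e \<notin> linked C" by (simp add: linked_insert_iff)
    have uv: "(u, v) \<notin> linked (insert e C)"
      using insert_loop_iff[of u v e C] Cons.prems(4) False by blast
    have "tree_count V ?E (insert (u, v) (insert e C)) \<le> tree_count V ?E (insert e C)"
      using Cons.IH[OF apart_insert[OF Cons.prems(1)] Cons.prems(2,3) uv] Cons.prems(5) by simp
    then show ?thesis using IH False eC by (simp add: insert_commute)
  qed
qed

lemma double_cone_product_bound:
  assumes "apart C x y (set ws)" "length ws \<ge> 2" and V: "V = {x, y} \<union> set ws"
    and n: "n = length ws + 2"
  shows "27 / (real n)\<^sup>2 * (3 / 2) ^ (n - 4) * (real (tree_count V (double_cone x y ws) C))\<^sup>2
    \<le> real (acyclic_count (double_cone x y ws) C) * real (strong_count V (double_cone x y ws) C)"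
proof -
  have ap: "\<forall>a\<in>set ws. (a, x) \<notin> linked C \<and> (a, y) \<notin> linked C" "(x, y) \<notin> linked C"
    using assms(1) by (auto simp: apart_def)
  obtain Ks where Ks: "blocks C x y Ks" "mset (concat Ks) = mset ws"
    using blocks_exist[OF ap(1)] by blast
  define ss where "ss = map length Ks"
  have sum: "sum_list ss = length ws"
    using mset_eq_length[OF Ks(2)] by (simp add: ss_def length_concat)
  have "\<forall>K\<in>set Ks. K \<noteq> []" using Ks(1) by (induction Ks) auto
  then have pos: "\<forall>s\<in>set ss. s \<ge> 1" by (auto simp: ss_def Suc_le_eq)
  let ?D = "\<Prod>s\<leftarrow>ss. 2 * real s" and ?P = "\<Prod>s\<leftarrow>ss. 4 ^ s - 2 :: real"
  let ?N = "\<Prod>s\<leftarrow>ss. 2 * 2 ^ s - 3 :: real"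
  have acyclic_count: "real (acyclic_count (double_cone x y ws) C) = 2 * 3 ^ length ss"
    using acyclic_count_double_cone[OF Ks ap(2)] by (simp add: ss_def)
  have prods: "real_of_int (\<Prod>K\<leftarrow>Ks. 4 ^ length K - 2) = ?P"
    "real_of_int (\<Prod>K\<leftarrow>Ks. 2 * 2 ^ length K - 3) = ?N"
    "real (\<Prod>K\<leftarrow>Ks. 2 * length K) = ?D"
    unfolding ss_def by (induction Ks) auto
  have "real (strong_count V (double_cone x y ws) C) = real_of_int (int (strong_count V (double_cone x y ws) C))" by simp
  also have "\<dots> = 2 * (?P - ?N)"
    unfolding V strong_count_double_cone[OF Ks ap(2)] of_int_mult of_int_diff prods by simp
  finally have strong_count: "real (strong_count V (double_cone x y ws) C) = 2 * (?P - ?N)" .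
  have "real (2 * tree_count V (double_cone x y ws) C) = real n * ?D"
    unfolding V tree_count_double_cone[OF Ks ap(2)] of_nat_mult prods n by simp
  then have tree_count: "real (tree_count V (double_cone x y ws) C) = real n * ?D / 2" by simp
  obtain m where "length ws = m + 2" using assms(2) by (metis add.commute le_Suc_ex)
  then have "(3 / 2 :: real) ^ length ws = (3 / 2) ^ (n - 4) * (3 / 2) ^ 2"
    using n by (simp add: power_add power2_eq_square)
  then have pw: "(3 / 2 :: real) ^ (n - 4) = (3 / 2) ^ length ws * (4 / 9)"
    by (simp add: power2_eq_square)
  have "27 / (real n)\<^sup>2 * (3 / 2) ^ (n - 4) * (real (tree_count V (double_cone x y ws) C))\<^sup>2
      = 3 * (3 / 2) ^ length ws * ?D\<^sup>2"
    unfolding tree_count pw using n by (simp add: power_divide power_mult_distrib)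
  also have "\<dots> \<le> 4 * 3 ^ length ss * (?P - ?N)"
    using blocks_ineq[OF pos] sum assms(2) by simp
  also have "\<dots> = real (acyclic_count (double_cone x y ws) C) * real (strong_count V (double_cone x y ws) C)"
    unfolding acyclic_count strong_count by simp
  finally show ?thesis .
qed

text \<open>
Induction over the number of edges between the vertices in \<open>ws\<close>. Excluding loops is essential, since
a loop makes the right side 0. After deleting or contracting a complete parallel class there are
again no loops.
\<close>

theorem product_bound:
  assumes "apart C x y (set ws)" "length ws \<ge> 2" and V: "V = {x, y} \<union> set ws"
    and n: "n = length ws + 2"
    and "set es \<subseteq> set ws \<times> set ws" "\<forall>e\<in>set es. e \<notin> linked C"
  shows "27 / (real n)\<^sup>2 * (3 / 2) ^ (n - 4) * (real (tree_count V (es @ double_cone x y ws) C))\<^sup>2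
    \<le> real (acyclic_count (es @ double_cone x y ws) C) * real (strong_count V (es @ double_cone x y ws) C)"
  using assms(1,5,6)
proof (induction "length es" arbitrary: es C rule: less_induct)
  case less
  let ?c = "27 / (real n)\<^sup>2 * (3 / 2) ^ (n - 4)"
  show ?case
  proof (cases es)
    case Nil
    then show ?thesis using double_cone_product_bound[OF less.prems(1) assms(2) V n] by simp
  next
    case (Cons e es')
    obtain u v where e: "e = (u, v)" by fastforce
    have uv: "u \<in> set ws" "v \<in> set ws" "(u, v) \<notin> linked C"
      using less.prems Cons e by auto
    \<comment> \<open>The whole parallel class of the first edge is removed at once.\<close>
    define ps where "ps = filter (parallel C (u, v)) es"
    define fs where "fs = filter (\<lambda>f. \<not> parallel C (u, v) f) es"
    define p where "p = length ps"
    let ?S = "fs @ double_cone x y ws"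
    have perm: "mset (es @ double_cone x y ws) = mset (ps @ ?S)"
      by (simp add: ps_def fs_def flip: multiset_partition)
    have par: "\<forall>q\<in>set ps. parallel C (u, v) q" by (simp add: ps_def)
    have ps: "ps \<noteq> []" using Cons e by (simp add: ps_def)
    then have p: "p \<ge> 1" by (simp add: p_def Suc_le_eq)
    have psV: "set ps \<subseteq> set ws \<times> set ws" using less.prems(2) by (auto simp: ps_def)
    have fsW: "set fs \<subseteq> set ws \<times> set ws" using less.prems(2) by (auto simp: fs_def)
    have len: "length fs < length es"
      unfolding fs_def using Cons e by (intro length_filter_less[of e]) auto
    have A: "acyclic_count (es @ double_cone x y ws) C = acyclic_count ?S C + acyclic_count ?S (insert (u, v) C)"
      using acyclic_count_perm[OF perm] acyclic_count_parallel[OF ps par uv(3)] by simp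
    have T: "tree_count V (es @ double_cone x y ws) C = tree_count V ?S C + p * tree_count V ?S (insert (u, v) C)"
      using tree_count_perm[OF perm] tree_count_parallel[OF par uv(3)] by (simp add: p_def)
    have "strong_count V (ps @ ?S) C = strong_count V ?S C + (2 ^ length ps - 1) * strong_count V ?S (insert (u, v) C)"
    proof (rule strong_count_parallel[of u V v x])
      show "adjacent_mod ?S C x v" using uv by (intro adjacent_mod_edge) (auto simp: double_cone_def)
      have "adjacent_mod ?S C x u" using uv by (intro adjacent_mod_edge) (auto simp: double_cone_def)
      then show "adjacent_mod ?S C u x" by (rule adjacent_mod_sym)
    qed (use uv V par psV in auto)
    then have "strong_count V (es @ double_cone x y ws) C = strong_count V ?S C + (2 ^ p - 1) * strong_count V ?S (insert (u, v) C)"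
      using strong_count_perm[OF perm] by (simp add: p_def)
    then have B: "real (strong_count V (es @ double_cone x y ws) C) = strong_count V ?S C + (2 ^ p - 1) * strong_count V ?S (insert (u, v) C)"
      by (simp add: of_nat_diff)
    have 0: "?c * (real (tree_count V ?S C))\<^sup>2 \<le> real (acyclic_count ?S C) * real (strong_count V ?S C)"
      by (rule less.hyps[OF len less.prems(1) fsW]) (use less.prems(3) in \<open>auto simp: fs_def\<close>)
    have 1: "?c * (real (tree_count V ?S (insert (u, v) C)))\<^sup>2
        \<le> real (acyclic_count ?S (insert (u, v) C)) * real (strong_count V ?S (insert (u, v) C))"
    proof (rule less.hyps[OF len _ fsW])
      show "apart (insert (u, v) C) x y (set ws)" using less.prems(1) uv by (simp add: apart_insert)
      show "\<forall>f\<in>set fs. f \<notin> linked (insert (u, v) C)"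
        using less.prems(3) by (auto simp: fs_def linked_insert_iff dest: parallel_sym)
    qed
    have "?c * (real (tree_count V ?S C) + real p * real (tree_count V ?S (insert (u, v) C)))\<^sup>2
      \<le> (real (acyclic_count ?S C) + real (acyclic_count ?S (insert (u, v) C))) *
         (real (strong_count V ?S C) + (2 ^ p - 1) * real (strong_count V ?S (insert (u, v) C)))"
    proof (rule step_ineq[OF 0 1 _ _ _ _ _ _ _ p])
      show "3 * real (acyclic_count ?S (insert (u, v) C)) \<le> real (acyclic_count ?S C)"
        using acyclic_count_contract_le[OF less.prems(1) uv fsW] by linarith
      show "real (tree_count V ?S (insert (u, v) C)) \<le> real (tree_count V ?S C)"
        using tree_count_contract_le[OF less.prems(1) uv fsW V] by simp
      show "real (strong_count V ?S C) \<le> real (strong_count V ?S (insert (u, v) C))"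
        using strong_count_contract_mono by simp
    qed simp_all
    then show ?thesis unfolding A T B by simp
  qed
qed

section \<open>Orientations of a simple graph given by an edge list\<close>

text \<open>
The list contains each edge of a simple graph once, in one of its two directions.
\<close>

fun simple_edges :: "('v \<times> 'v) list \<Rightarrow> bool" where
  "simple_edges [] = True"
| "simple_edges ((u, v) # es) \<longleftrightarrow>
     u \<noteq> v \<and> (u, v) \<notin> set es \<and> (v, u) \<notin> set es \<and> simple_edges es"

lemma simple_edgesD:
  "simple_edges es \<Longrightarrow> (a, b) \<in> set es \<Longrightarrow> a \<noteq> b \<and> (b, a) \<notin> set es"
  by (induction es rule: simple_edges.induct) auto

lemma simple_edges_append:
  "simple_edges (es @ fs) \<longleftrightarrow> simple_edges es \<and> simple_edges fs \<and>
     set es \<inter> (set fs \<union> (set fs)\<inverse>) = {}"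
  by (induction es rule: simple_edges.induct) auto

definition orientations :: "('v \<times> 'v) list \<Rightarrow> 'v rel set" where
  "orientations es = {R. R \<subseteq> set es \<union> (set es)\<inverse> \<and>
     (\<forall>u v. (u, v) \<in> set es \<longrightarrow> ((u, v) \<in> R) \<noteq> ((v, u) \<in> R))}"

lemma finite_orientations [simp]: "finite (orientations es)"
  by (rule finite_subset[of _ "Pow (set es \<union> (set es)\<inverse>)"]) (auto simp: orientations_def)

lemma orientations_Cons:
  assumes "simple_edges ((u, v) # es)"
  shows "orientations ((u, v) # es) =
    insert (u, v) ` orientations es \<union> insert (v, u) ` orientations es"
proof (intro set_eqI iffI)
  fix R assume R: "R \<in> orientations ((u, v) # es)"
  define R' where "R' = R - {(u, v), (v, u)}"
  have uv: "u \<noteq> v" "(u, v) \<notin> set es" "(v, u) \<notin> set es" using assms by auto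
  have "R' \<in> orientations es"
    unfolding orientations_def
  proof (intro CollectI conjI allI impI)
    show "R' \<subseteq> set es \<union> (set es)\<inverse>" using R by (auto simp: orientations_def R'_def)
  next
    fix a b assume ab: "(a, b) \<in> set es"
    then have "((a, b) \<in> R) \<noteq> ((b, a) \<in> R)" using R by (auto simp: orientations_def)
    moreover have "(a, b) \<notin> {(u, v), (v, u)}" "(b, a) \<notin> {(u, v), (v, u)}" using ab uv by auto
    ultimately show "((a, b) \<in> R') \<noteq> ((b, a) \<in> R')" by (simp add: R'_def)
  qed
  moreover have "((u, v) \<in> R) \<noteq> ((v, u) \<in> R)" using R by (simp add: orientations_def)
  then have "R = insert (u, v) R' \<or> R = insert (v, u) R'" by (auto simp: R'_def)
  ultimately show "R \<in> insert (u, v) ` orientations es \<union> insert (v, u) ` orientations es" by blast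
next
  fix R assume "R \<in> insert (u, v) ` orientations es \<union> insert (v, u) ` orientations es"
  then obtain R' where R': "R' \<in> orientations es" "R = insert (u, v) R' \<or> R = insert (v, u) R'" by blast
  have uv: "u \<noteq> v" "(u, v) \<notin> set es" "(v, u) \<notin> set es" using assms by auto
  have n: "(u, v) \<notin> R'" "(v, u) \<notin> R'" using R'(1) uv by (auto simp: orientations_def)
  show "R \<in> orientations ((u, v) # es)"
    unfolding orientations_def
  proof (intro CollectI conjI allI impI)
    show "R \<subseteq> set ((u, v) # es) \<union> (set ((u, v) # es))\<inverse>"
      using R' by (auto simp: orientations_def)
  next
    fix a b assume ab: "(a, b) \<in> set ((u, v) # es)"
    show "((a, b) \<in> R) \<noteq> ((b, a) \<in> R)"
    proof (cases "(a, b) = (u, v)")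
      case True
      then show ?thesis using R'(2) n uv by auto
    next
      case False
      then have "(a, b) \<in> set es" using ab by auto
      then have "((a, b) \<in> R') \<noteq> ((b, a) \<in> R')" "(a, b) \<notin> {(u, v), (v, u)}" "(b, a) \<notin> {(u, v), (v, u)}"
        using R'(1) uv by (auto simp: orientations_def)
      then show ?thesis using R'(2) by auto
    qed
  qed
qed

lemma orient_sum_eq:
  "simple_edges es \<Longrightarrow> orient_sum es f = (\<Sum>R\<in>orientations es. f R)"
proof (induction es arbitrary: f rule: simple_edges.induct)
  case 1
  have "orientations [] = {{} :: 'a rel}" by (auto simp: orientations_def)
  then show ?case by simp
next
  case (2 u v es)
  have uv: "u \<noteq> v" "(u, v) \<notin> set es" "(v, u) \<notin> set es" "simple_edges es" using 2(2) by auto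
  have n: "(u, v) \<notin> R" "(v, u) \<notin> R" if "R \<in> orientations es" for R
    using that uv by (auto simp: orientations_def)
  have inj: "inj_on (insert (u, v)) (orientations es)" "inj_on (insert (v, u)) (orientations es)"
    using n by (meson inj_onI insert_ident)+
  have "insert (u, v) ` orientations es \<inter> insert (v, u) ` orientations es = {}"
    using n uv(1) by (auto simp: set_eq_iff) (metis prod.inject)
  then have "(\<Sum>R\<in>orientations ((u, v) # es). f R) =
      (\<Sum>R\<in>insert (u, v) ` orientations es. f R) + (\<Sum>R\<in>insert (v, u) ` orientations es. f R)"
    unfolding orientations_Cons[OF 2(2)] by (intro sum.union_disjoint) auto
  also have "\<dots> = (\<Sum>R\<in>orientations es. f (insert (u, v) R)) + (\<Sum>R\<in>orientations es. f (insert (v, u) R))"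
    by (simp add: sum.reindex[OF inj(1)] sum.reindex[OF inj(2)])
  finally show ?case using 2(1)[OF uv(4)] by simp
qed

lemma orient_sum_card:
  assumes "simple_edges es"
  shows "orient_sum es (\<lambda>R. of_bool (P R)) = card {R \<in> orientations es. P R}"
proof -
  have "orient_sum es (\<lambda>R. of_bool (P R)) = (\<Sum>R\<in>orientations es. if P R then 1 else 0)"
    unfolding orient_sum_eq[OF assms] by (intro sum.cong) auto
  also have "\<dots> = card {R \<in> orientations es. P R}" by (simp add: sum.If_cases Int_def)
  finally show ?thesis .
qed

lemma linked_empty [simp]: "linked {} = Id"
  by (simp add: linked_def)

lemma acyclic_mod_empty: "acyclic_mod {} R \<longleftrightarrow> acyclic R"
proof -
  have "(R \<union> Id)\<^sup>* = R\<^sup>*" by (metis Un_commute rtrancl_reflcl)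
  then show ?thesis
    unfolding acyclic_mod_def acyclic_def linked_empty
    by (auto simp: trancl_unfold_left intro: rtrancl_into_trancl2 dest: rtrancl_into_trancl2)
qed

section \<open>Directed cycles and reachability\<close>

lemma pcas_rtrancl: "pcas u p v \<Longrightarrow> set p \<subseteq> A \<Longrightarrow> (u, v) \<in> A\<^sup>*"
proof (induction u p v rule: pcas.induct)
  case (2 u e es v)
  then have "(u, snd e) \<in> A" by (metis list.set_intros(1) pcas.simps(2) prod.collapse subsetD)
  moreover have "(snd e, v) \<in> A\<^sup>*" using 2 by auto
  ultimately show ?case by (rule converse_rtrancl_into_rtrancl)
qed simp

lemma pcas_append: "pcas u (p @ q) v \<longleftrightarrow> (\<exists>w. pcas u p w \<and> pcas w q v)"
  by (induction p arbitrary: u) auto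

lemma (in pair_wf_digraph) rtrancl_apath:
  assumes "(u, v) \<in> (parcs G)\<^sup>*" "u \<in> pverts G"
  obtains p where "apath u p v"
proof -
  have "u \<rightarrow>\<^sup>*\<^bsub>with_proj G\<^esub> v"
    using assms
  proof (induction rule: rtrancl_induct)
    case (step b c)
    then show ?case by (simp add: reachable_adj_trans)
  qed simp
  then show ?thesis using that by (auto simp: reachable_apath)
qed

lemma (in pair_wf_digraph) forest_iff_acyclic: "forest (with_proj G) \<longleftrightarrow> acyclic (parcs G)"
proof
  assume f: "forest (with_proj G)"
  show "acyclic (parcs G)"
    unfolding acyclic_def
  proof (intro allI notI)
    fix u assume "(u, u) \<in> (parcs G)\<^sup>+"
    then obtain p where "awalk u p u" "p \<noteq> []" using reachable1_awalk by auto
    then have "closed_w p" by (auto simp: closed_w_def)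
    then show False using closed_w_imp_cycle f by (auto simp: forest_def)
  qed
next
  assume a: "acyclic (parcs G)"
  show "forest (with_proj G)"
    unfolding forest_def
  proof
    assume "\<exists>p. cycle p"
    then obtain u p where "awalk u p u" "p \<noteq> []" by (auto simp: cycle_def)
    then have "(u, u) \<in> (parcs G)\<^sup>+" using reachable1_awalk by auto
    then show False using a by (auto simp: acyclic_def)
  qed
qed

lemma (in pair_wf_digraph) arc_in_cycle:
  assumes "(a, b) \<in> parcs G" "apath b p a" shows "cycle ((a, b) # p)"
  using assms by (auto simp: cycle_def apath_def awalk_Cons_iff in_arcsD1)

text \<open>
If every arc lies on a directed cycle, then each arc can be traversed backwards by following the
rest of its cycle, so every undirected path can be replaced by a directed one.
\<close>

lemma (in pair_wf_digraph) totally_cyclic_iff_strong: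
  assumes "pverts G \<times> pverts G \<subseteq> (parcs G \<union> (parcs G)\<inverse>)\<^sup>*"
  shows "totally_cyclic G \<longleftrightarrow> strong (pverts G) (parcs G)"
proof
  assume t: "totally_cyclic G"
  have "(b, a) \<in> (parcs G)\<^sup>*" if ab: "(a, b) \<in> parcs G" for a b
  proof -
    obtain u p where p: "awalk u p u" "(a, b) \<in> set p"
      using t ab by (auto simp: totally_cyclic_def cycle_def)
    obtain p1 p2 where "p = p1 @ (a, b) # p2" using p(2) by (meson split_list)
    then have "pcas u p1 a" "pcas b p2 u" "set p1 \<subseteq> parcs G" "set p2 \<subseteq> parcs G"
      using p(1) by (auto simp: awalk_def pcas_append)
    then have "(u, a) \<in> (parcs G)\<^sup>*" "(b, u) \<in> (parcs G)\<^sup>*" using pcas_rtrancl by metis+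
    then show ?thesis by (meson rtrancl_trans)
  qed
  then have "parcs G \<union> (parcs G)\<inverse> \<subseteq> (parcs G)\<^sup>*" by auto
  then have "(parcs G \<union> (parcs G)\<inverse>)\<^sup>* \<subseteq> (parcs G)\<^sup>*" by (metis rtrancl_idemp rtrancl_mono)
  then show "strong (pverts G) (parcs G)" using assms by (auto simp: strong_def)
next
  assume s: "strong (pverts G) (parcs G)"
  show "totally_cyclic G"
    unfolding totally_cyclic_def
  proof
    fix e assume e: "e \<in> parcs G"
    obtain a b where ab: "e = (a, b)" by fastforce
    have "a \<in> pverts G" "b \<in> pverts G" using e ab in_arcsD1 in_arcsD2 by auto
    then have "(b, a) \<in> (parcs G)\<^sup>*" using s by (simp add: strong_def)
    then obtain p where "apath b p a" using \<open>b \<in> pverts G\<close> by (rule rtrancl_apath)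
    then have "cycle (e # p)" using arc_in_cycle e ab by simp
    then show "\<exists>p. cycle p \<and> e \<in> set p" by (intro exI[of _ "e # p"]) simp
  qed
qed

section \<open>The orientation counts of a graph\<close>

definition graph_of :: "'v set \<Rightarrow> ('v \<times> 'v) list \<Rightarrow> 'v pair_pre_digraph" where
  "graph_of V es = \<lparr>pverts = V, parcs = set es \<union> (set es)\<inverse>\<rparr>"

lemma orientation_graph_of:
  "orientation (graph_of V es) D \<longleftrightarrow> pverts D = V \<and> parcs D \<in> orientations es"
  unfolding orientation_def graph_of_def orientations_def by auto

lemma card_orientations_with:
  assumes "\<And>R. R \<in> orientations es \<Longrightarrow> P \<lparr>pverts = V, parcs = R\<rparr> \<longleftrightarrow> Q' R"
  shows "card {D. orientation (graph_of V es) D \<and> P D} = card {R \<in> orientations es. Q' R}"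
proof (rule bij_betw_same_card)
  show "bij_betw parcs {D. orientation (graph_of V es) D \<and> P D} {R \<in> orientations es. Q' R}"
    unfolding bij_betw_def
  proof (intro conjI set_eqI iffI)
    show "inj_on parcs {D. orientation (graph_of V es) D \<and> P D}"
      by (rule inj_onI) (auto simp: orientation_graph_of)
  next
    fix R assume "R \<in> parcs ` {D. orientation (graph_of V es) D \<and> P D}"
    then obtain D where D: "pverts D = V" "parcs D = R" "R \<in> orientations es" "P D"
      by (auto simp: orientation_graph_of)
    then have "D = \<lparr>pverts = V, parcs = R\<rparr>" by simp
    then show "R \<in> {R \<in> orientations es. Q' R}" using assms[of R] D(3,4) by simp
  next
    fix R assume R: "R \<in> {R \<in> orientations es. Q' R}"
    then have "\<lparr>pverts = V, parcs = R\<rparr> \<in> {D. orientation (graph_of V es) D \<and> P D}"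
      using assms[of R] by (simp add: orientation_graph_of)
    then show "R \<in> parcs ` {D. orientation (graph_of V es) D \<and> P D}"
      by (metis (no_types, lifting) image_eqI pair_pre_digraph.select_convs(2))
  qed
qed

context
  fixes V :: "'v set" and es :: "('v \<times> 'v) list"
  assumes simple: "simple_edges es" and es_V: "set es \<subseteq> V \<times> V"
begin

lemma oriented_wf:
  assumes "R \<in> orientations es" shows "pair_wf_digraph \<lparr>pverts = V, parcs = R\<rparr>"
proof -
  have "R \<subseteq> V \<times> V" using assms es_V by (auto simp: orientations_def)
  then show ?thesis by unfold_locales auto
qed

lemma num_acyclic_orientations_eq: "num_acyclic_orientations (graph_of V es) = acyclic_count es {}"
proof -
  have "num_acyclic_orientations (graph_of V es) = card {R \<in> orientations es. acyclic_mod {} R}"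
    unfolding num_acyclic_orientations_def
    by (rule card_orientations_with)
      (simp add: pair_wf_digraph.forest_iff_acyclic[OF oriented_wf] acyclic_mod_empty)
  then show ?thesis by (simp add: acyclic_count_def orient_sum_card[OF simple])
qed

lemma num_totally_cyclic_orientations_eq:
  assumes con: "V \<times> V \<subseteq> linked (set es)"
  shows "num_totally_cyclic_orientations (graph_of V es) = strong_count V es {}"
proof -
  have "num_totally_cyclic_orientations (graph_of V es) = card {R \<in> orientations es. strong V (R \<union> linked {})}"
    unfolding num_totally_cyclic_orientations_def
  proof (rule card_orientations_with)
    fix R assume R: "R \<in> orientations es"
    interpret pair_wf_digraph "\<lparr>pverts = V, parcs = R\<rparr>" using R by (rule oriented_wf)
    have "set es \<subseteq> R \<union> R\<inverse>" using R by (auto simp: orientations_def)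
    then have "linked (set es) \<subseteq> (R \<union> R\<inverse>)\<^sup>*" unfolding linked_def by (intro rtrancl_mono) auto
    then have "totally_cyclic \<lparr>pverts = V, parcs = R\<rparr> \<longleftrightarrow> strong V R"
      using totally_cyclic_iff_strong con by simp
    moreover have "(R \<union> Id)\<^sup>* = R\<^sup>*" by (metis Un_commute rtrancl_reflcl)
    then have "strong V (R \<union> linked {}) = strong V R" by (simp add: strong_def)
    ultimately show "totally_cyclic \<lparr>pverts = V, parcs = R\<rparr> \<longleftrightarrow> strong V (R \<union> linked {})" by simp
  qed
  then show ?thesis by (simp add: strong_count_def orient_sum_card[OF simple])
qed

end

section \<open>The spanning trees of a graph\<close>

text \<open>
\<open>S\<close> has no cycle in the minor given by \<open>C\<close>. In contrast to the recursion of \<open>tree_count\<close>, this does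
not depend on an order of the edges.
\<close>

definition forest_mod :: "'v rel \<Rightarrow> 'v rel \<Rightarrow> bool" where
  "forest_mod C S \<longleftrightarrow> (\<forall>e\<in>S. e \<notin> linked (C \<union> (S - {e})))"

text \<open>
Add the edges of \<open>S\<close> one by one. The first one that links the ends of \<open>e\<close> is itself linked by \<open>e\<close> and
the edges before it.
\<close>

lemma forest_exchange:
  assumes "finite S" "e \<in> linked (C \<union> S)" "e \<notin> linked C"
  shows "\<exists>f\<in>S. f \<in> linked (insert e C \<union> (S - {f}))"
  using assms(1,2)
proof (induction S rule: finite_induct)
  case empty
  then show ?case using assms(3) by simp
next
  case (insert g S)
  show ?case
  proof (cases "e \<in> linked (C \<union> S)")
    case True
    then obtain f where f: "f \<in> S" "f \<in> linked (insert e C \<union> (S - {f}))" using insert.IH by blast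
    have "linked (insert e C \<union> (S - {f})) \<subseteq> linked (insert e C \<union> (insert g S - {f}))"
      by (rule linked_mono) auto
    then show ?thesis using f by blast
  next
    case False
    have "e \<in> linked (insert g (C \<union> S))" using insert.prems by simp
    then have "g \<in> linked (insert e (C \<union> S))"
      using insert_loop_iff[of "fst e" "snd e" g "C \<union> S"] False by simp
    moreover have "insert g S - {g} = S" using insert.hyps by auto
    ultimately show ?thesis by auto
  qed
qed

lemma forest_mod_insert:
  assumes "finite S" "e \<notin> S"
  shows "forest_mod C (insert e S) \<longleftrightarrow> e \<notin> linked C \<and> forest_mod (insert e C) S"
proof -
  have 1: "insert e S - {e} = S" using assms(2) by auto
  have 2: "C \<union> (insert e S - {f}) = insert e C \<union> (S - {f})" if "f \<in> S" for f
    using that assms(2) by auto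
  have "linked C \<subseteq> linked (C \<union> S)" by (rule linked_mono) auto
  then show ?thesis using forest_exchange[OF assms(1), of e C] unfolding forest_mod_def by (auto simp: 1 2)
qed

lemma tree_count_eq_card:
  assumes "distinct es"
  shows "tree_count V es C = card {S. S \<subseteq> set es \<and> V \<times> V \<subseteq> linked (C \<union> S) \<and> forest_mod C S}"
  using assms
proof (induction es arbitrary: C)
  case Nil
  have "{S. S \<subseteq> set [] \<and> V \<times> V \<subseteq> linked (C \<union> S) \<and> forest_mod C S} = (if V \<times> V \<subseteq> linked C then {{}} else {})"
    by (auto simp: forest_mod_def)
  then show ?case by simp
next
  case (Cons e es)
  let ?T = "\<lambda>es C. {S. S \<subseteq> set es \<and> V \<times> V \<subseteq> linked (C \<union> S) \<and> forest_mod C S}"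
  have e: "e \<notin> set es" using Cons.prems by simp
  have ins: "forest_mod C (insert e S) \<longleftrightarrow> e \<notin> linked C \<and> forest_mod (insert e C) S" if "S \<subseteq> set es" for S
    using that e by (intro forest_mod_insert finite_subset[OF that]) auto
  have un: "C \<union> insert e S = insert e C \<union> S" for S by auto
  have "?T (e # es) C = ?T es C \<union> (if e \<in> linked C then {} else insert e ` ?T es (insert e C))"
  proof (intro set_eqI iffI)
    fix S assume S: "S \<in> ?T (e # es) C"
    show "S \<in> ?T es C \<union> (if e \<in> linked C then {} else insert e ` ?T es (insert e C))"
    proof (cases "e \<in> S")
      case True
      define S' where "S' = S - {e}"
      have S': "S = insert e S'" "S' \<subseteq> set es" using S True by (auto simp: S'_def)
      then have "e \<notin> linked C" "S' \<in> ?T es (insert e C)" using S ins[of S'] un[of S'] by auto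
      then show ?thesis using S'(1) by auto
    qed (use S in auto)
  next
    fix S assume "S \<in> ?T es C \<union> (if e \<in> linked C then {} else insert e ` ?T es (insert e C))"
    then consider "S \<in> ?T es C"
      | S' where "e \<notin> linked C" "S = insert e S'" "S' \<in> ?T es (insert e C)"
      by (auto split: if_splits)
    then show "S \<in> ?T (e # es) C"
    proof cases
      case 2
      then show ?thesis using ins[of S'] un[of S'] by auto
    qed auto
  qed
  moreover have "finite (?T es C')" for C' by (rule finite_subset[of _ "Pow (set es)"]) auto
  moreover have "?T es C \<inter> insert e ` ?T es (insert e C) = {}" using e by auto
  moreover have "inj_on (insert e) (?T es (insert e C))"
  proof (rule inj_onI)
    fix S S' assume "S \<in> ?T es (insert e C)" "S' \<in> ?T es (insert e C)" "insert e S = insert e S'"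
    then show "S = S'" using e by (intro insert_ident[THEN iffD1, of e S S']) auto
  qed
  ultimately have "card (?T (e # es) C) = card (?T es C) + (if e \<in> linked C then 0 else card (?T es (insert e C)))"
    by (simp add: card_Un_disjoint card_image)
  then show ?case using Cons by simp
qed

lemma simple_edges_distinct: "simple_edges es \<Longrightarrow> distinct es"
  by (induction es rule: simple_edges.induct) auto

context
  fixes V :: "'v set" and es :: "('v \<times> 'v) list" and S :: "'v rel"
  assumes simple: "simple_edges es" and es_V: "set es \<subseteq> V \<times> V" and finV: "finite V" and S: "S \<subseteq> set es"
begin

interpretation T: pair_graph "\<lparr>pverts = V, parcs = S \<union> S\<inverse>\<rparr>"
proof
  have "finite (set es)" by simp
  then show "finite (parcs \<lparr>pverts = V, parcs = S \<union> S\<inverse>\<rparr>)" using S finite_subset by auto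
  show "symmetric (with_proj \<lparr>pverts = V, parcs = S \<union> S\<inverse>\<rparr>)" by (auto simp: symmetric_def sym_def)
qed (use S es_V finV simple_edgesD[OF simple] in auto)

lemma subset_pair_graph: "pair_graph \<lparr>pverts = V, parcs = S \<union> S\<inverse>\<rparr>" by (rule T.pair_graph_axioms)

lemma connected_iff_linked:
  assumes "V \<noteq> {}"
  shows "Digraph_Component.connected (with_proj \<lparr>pverts = V, parcs = S \<union> S\<inverse>\<rparr>) \<longleftrightarrow> V \<times> V \<subseteq> linked S"
proof -
  let ?T = "\<lparr>pverts = V, parcs = S \<union> S\<inverse>\<rparr>"
  have "(u \<rightarrow>\<^sup>*\<^bsub>with_proj ?T\<^esub> v) \<longleftrightarrow> (u, v) \<in> linked S" if uV: "u \<in> V" for u v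
  proof
    assume "u \<rightarrow>\<^sup>*\<^bsub>with_proj ?T\<^esub> v"
    then show "(u, v) \<in> linked S"
      unfolding T.reachable_awalk linked_def using pcas_rtrancl[of u _ v "S \<union> S\<inverse>"]
      by (auto simp: T.awalk_def)
  next
    assume "(u, v) \<in> linked S"
    then have "(u, v) \<in> (parcs ?T)\<^sup>*" by (simp add: linked_def)
    then obtain p where "T.apath u p v" by (rule T.rtrancl_apath) (use uV in simp)
    then show "u \<rightarrow>\<^sup>*\<^bsub>with_proj ?T\<^esub> v" unfolding T.reachable_apath by blast
  qed
  then show ?thesis
    unfolding Digraph_Component.connected_def strongly_connected_def
    using T.reachable_mk_symmetric_eq[OF T.pair_sym_arcs] assms by auto
qed

text \<open>
An edge with linked ends closes a simple path of the other edges. This path has at least two edges,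
because the graph has neither loops nor parallel edges.
\<close>

lemma long_cycle_if_dependent:
  assumes "\<not> forest_mod {} S"
  shows "\<exists>p. T.cycle p \<and> length p \<ge> 3"
proof -
  obtain a b where ab: "(a, b) \<in> S" "(a, b) \<in> linked (S - {(a, b)})"
    using assms by (auto simp: forest_mod_def)
  let ?X = "S - {(a, b)}"
  have nab: "a \<noteq> b" "(b, a) \<notin> S" "a \<in> V" "b \<in> V"
    using ab(1) S simple_edgesD[OF simple, of a b] es_V by auto
  interpret X: pair_wf_digraph "\<lparr>pverts = V, parcs = ?X \<union> ?X\<inverse>\<rparr>"
    by unfold_locales (use S es_V in auto)
  have "(b, a) \<in> (parcs \<lparr>pverts = V, parcs = ?X \<union> ?X\<inverse>\<rparr>)\<^sup>*"
    using linked_sym[OF ab(2)] by (simp add: linked_def)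
  then obtain p where p: "X.apath b p a" by (rule X.rtrancl_apath) (use nab in simp)
  then have p': "pcas b p a" "set p \<subseteq> ?X \<union> ?X\<inverse>" "distinct (pawalk_verts b p)"
    by (auto simp: X.apath_def X.awalk_def)
  have "T.apath b p a" using p' nab by (auto simp: T.apath_def T.awalk_def)
  then have "T.cycle ((a, b) # p)" using T.arc_in_cycle ab(1) by simp
  moreover have "length p \<ge> 2"
  proof (rule ccontr)
    assume "\<not> length p \<ge> 2"
    then consider "p = []" | e where "p = [e]" by (cases p; cases "tl p") auto
    then show False
    proof cases
      case 2
      then have "e = (b, a)" using p'(1) by (cases e) auto
      then show False using 2 p'(2) nab by auto
    qed (use p'(1) nab in simp)
  qed
  ultimately show ?thesis by (intro exI[of _ "(a, b) # p"]) simp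
qed

lemma pcas_verts_last: "pcas u p v \<Longrightarrow> v \<in> set (pawalk_verts u p)"
  by (induction u p v rule: pcas.induct) auto

lemma pawalk_verts_arc: "e \<in> set p \<Longrightarrow> fst e \<in> set (pawalk_verts u p)"
  by (induction p arbitrary: u) auto

lemma pawalk_verts_head: "pcas u p v \<Longrightarrow> e \<in> set p \<Longrightarrow> snd e \<in> set (tl (pawalk_verts u p))"
proof (induction u p v rule: pcas.induct)
  case (2 u f p v)
  have "snd f \<in> set (pawalk_verts (snd f) p)" by (cases p) (use 2 in auto)
  moreover have "set (tl (pawalk_verts (snd f) p)) \<subseteq> set (pawalk_verts (snd f) p)"
    by (cases "pawalk_verts (snd f) p") auto
  ultimately show ?case using 2 by auto
qed simp

text \<open>
The rest of a cycle links the ends of its first edge. It does not use this edge again, not even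
backwards: a vertex would be repeated unless the cycle were $a, b, a$, which has length 2.
\<close>

lemma dependent_if_long_cycle:
  assumes "T.cycle p" "length p \<ge> 3"
  shows "\<not> forest_mod {} S"
proof -
  obtain a b q where p: "p = (a, b) # q" using assms(2) by (cases p) auto
  have q: "(a, b) \<in> S \<union> S\<inverse>" "set q \<subseteq> S \<union> S\<inverse>" "pcas b q a" "distinct (pawalk_verts b q)"
    using assms(1) p by (auto simp: T.cycle_def T.awalk_def)
  have "(a, b) \<notin> set q"
  proof
    assume "(a, b) \<in> set q"
    then have "b \<in> set (tl (pawalk_verts b q))" using pawalk_verts_head[OF q(3)] by fastforce
    moreover have "hd (pawalk_verts b q) = b" using q(3) by (cases q) auto
    ultimately show False using q(4) by (cases "pawalk_verts b q") auto
  qed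
  moreover have "(b, a) \<notin> set q"
  proof
    assume ba: "(b, a) \<in> set q"
    obtain e r where r: "q = e # r" using assms(2) p by (cases q) auto
    have e: "fst e = b" using q(3) r by simp
    have "(b, a) \<notin> set r"
    proof
      assume "(b, a) \<in> set r"
      then show False using pawalk_verts_arc[of "(b, a)" r "snd e"] q(4) r e by simp
    qed
    then have "e = (b, a)" using ba r by simp
    moreover obtain f t where "r = f # t" using assms(2) p r by (cases r) auto
    ultimately have "a \<in> set (pawalk_verts (snd f) t)" "fst f = a" "distinct (pawalk_verts a (f # t))"
      using q(3,4) r pcas_verts_last[of "snd f" t a] by auto
    then show False by simp
  qed
  ultimately have qs: "set q \<subseteq> (S - {e}) \<union> (S - {e})\<inverse>" if "e = (a, b) \<or> e = (b, a)" for e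
    using q(2) that by auto
  have "\<exists>e\<in>S. e = (a, b) \<or> e = (b, a)" using q(1) by auto
  then obtain e where e: "e \<in> S" "e = (a, b) \<or> e = (b, a)" by blast
  have "(b, a) \<in> linked (S - {e})"
    unfolding linked_def using q(3) qs[OF e(2)] by (rule pcas_rtrancl)
  then have "e \<in> linked (S - {e})" using e(2) linked_sym[of b a "S - {e}"] by auto
  then show ?thesis using e(1) by (auto simp: forest_mod_def)
qed

lemma undirected_tree_iff:
  assumes "V \<noteq> {}"
  shows "undirected_tree \<lparr>pverts = V, parcs = S \<union> S\<inverse>\<rparr> \<longleftrightarrow> V \<times> V \<subseteq> linked S \<and> forest_mod {} S"
  unfolding undirected_tree_def
  using subset_pair_graph connected_iff_linked[OF assms] long_cycle_if_dependent
    dependent_if_long_cycle by blast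

end

lemma num_spanning_trees_eq:
  assumes simple: "simple_edges es" and es_V: "set es \<subseteq> V \<times> V" and V: "finite V" "V \<noteq> {}"
  shows "num_spanning_trees (graph_of V es) = tree_count V es {}"
proof -
  let ?g = "\<lambda>S. \<lparr>pverts = V, parcs = S \<union> S\<inverse>\<rparr>"
  let ?A = "{S. S \<subseteq> set es \<and> V \<times> V \<subseteq> linked ({} \<union> S) \<and> forest_mod {} S}"
  have wfG: "pair_wf_digraph (graph_of V es)"
    by unfold_locales (use es_V in \<open>auto simp: graph_of_def\<close>)
  have span: "spanning (with_proj (?g S)) (with_proj (graph_of V es))" if "S \<subseteq> set es" for S
  proof -
    have "pair_wf_digraph (?g S)" by unfold_locales (use that es_V in auto)
    then show ?thesis using that wfG
      by (auto simp: spanning_def subgraph_def graph_of_def compatible_def wf_digraph_wp_iff)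
  qed
  have "{T. undirected_tree T \<and> spanning (with_proj T) (with_proj (graph_of V es))} = ?g ` ?A"
  proof (intro set_eqI iffI)
    fix T assume T: "T \<in> {T. undirected_tree T \<and> spanning (with_proj T) (with_proj (graph_of V es))}"
    define S where "S = parcs T \<inter> set es"
    have T1: "pverts T = V" "parcs T \<subseteq> set es \<union> (set es)\<inverse>"
      using T by (auto simp: spanning_def subgraph_def graph_of_def)
    interpret T: pair_graph T using T by (simp add: undirected_tree_def)
    have "(b, a) \<in> parcs T" if "(a, b) \<in> parcs T" for a b
      using that T.pair_sym_arcs by (auto simp: symmetric_def sym_def)
    then have "parcs T = S \<union> S\<inverse>" using T1(2) by (auto simp: S_def)
    then have Tg: "T = ?g S" using T1(1) by simp
    have "S \<in> ?A"
      using undirected_tree_iff[OF simple es_V V(1) _ V(2), of S] T unfolding Tg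
      by (auto simp: S_def)
    then show "T \<in> ?g ` ?A" using Tg by blast
  next
    fix T assume "T \<in> ?g ` ?A"
    then obtain S where "T = ?g S" "S \<in> ?A" by blast
    then show "T \<in> {T. undirected_tree T \<and> spanning (with_proj T) (with_proj (graph_of V es))}"
      using undirected_tree_iff[OF simple es_V V(1) _ V(2), of S] span[of S] by simp
  qed
  moreover have "inj_on ?g ?A"
  proof (rule inj_onI)
    fix S S' assume SS: "S \<in> ?A" "S' \<in> ?A" "?g S = ?g S'"
    have "(S \<union> S\<inverse>) \<inter> set es = S" if "S \<subseteq> set es" for S
      using that simple_edgesD[OF simple] by auto
    moreover have "S \<union> S\<inverse> = S' \<union> S'\<inverse>" using SS(3) by simp
    ultimately show "S = S'" using SS(1,2) by (metis (no_types, lifting) mem_Collect_eq)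
  qed
  ultimately show ?thesis
    unfolding num_spanning_trees_def
    using tree_count_eq_card[OF simple_edges_distinct[OF simple], of V "{}"] by (simp add: card_image)
qed

section \<open>The join with two adjacent vertices\<close>

lemma edge_list_exists:
  assumes "finite E" "sym E" "irrefl E"
  obtains es where "simple_edges es" "set es \<union> (set es)\<inverse> = E"
  using assms
proof (induction E arbitrary: thesis rule: finite_psubset_induct)
  case (psubset E)
  show ?case
  proof (cases "E = {}")
    case True
    then show ?thesis using psubset.prems(1)[of "[]"] by simp
  next
    case False
    then obtain a b where ab: "(a, b) \<in> E" by auto
    then have ba: "(b, a) \<in> E" "a \<noteq> b" using psubset.prems(2,3) by (auto simp: sym_def irrefl_def)
    let ?E = "E - {(a, b), (b, a)}"
    have "?E \<subset> E" using ab by auto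
    moreover have "sym ?E" "irrefl ?E" using psubset.prems(2,3) by (auto simp: sym_def irrefl_def)
    ultimately obtain es where es: "simple_edges es" "set es \<union> (set es)\<inverse> = ?E"
      using psubset.IH[of ?E] by blast
    have "simple_edges ((a, b) # es)" using es ba(2) by auto
    moreover have "set ((a, b) # es) \<union> (set ((a, b) # es))\<inverse>
        = insert (a, b) (insert (b, a) (set es \<union> (set es)\<inverse>))" by auto
    then have "set ((a, b) # es) \<union> (set ((a, b) # es))\<inverse> = E" using es(2) ab ba(1) by auto
    ultimately show ?thesis using psubset.prems(1) by blast
  qed
qed

lemma set_double_cone: "set (double_cone x y ws) = insert (x, y) ({x, y} \<times> set ws)"
  by (auto simp: double_cone_def)

lemma simple_edges_spokes:
  "distinct ws \<Longrightarrow> z \<notin> set ws \<Longrightarrow> simple_edges (map (Pair z) ws)"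
  by (induction ws) auto

lemma simple_edges_double_cone:
  assumes "distinct ws" "x \<notin> set ws" "y \<notin> set ws" "x \<noteq> y"
  shows "simple_edges (double_cone x y ws)"
  unfolding double_cone_def simple_edges_append using assms simple_edges_spokes[OF assms(1)] by auto

lemma tree_count_append_ge: "tree_count V fs C \<le> tree_count V (es @ fs) C"
  by (induction es arbitrary: C) (auto intro: trans_le_add1)

lemma tree_count_double_cone_pos:
  assumes "apart C x y (set ws)"
  shows "tree_count ({x, y} \<union> set ws) (double_cone x y ws) C > 0"
proof -
  have ap: "\<forall>a\<in>set ws. (a, x) \<notin> linked C \<and> (a, y) \<notin> linked C" "(x, y) \<notin> linked C"
    using assms by (auto simp: apart_def)
  obtain Ks where Ks: "blocks C x y Ks" "mset (concat Ks) = mset ws"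
    using blocks_exist[OF ap(1)] by blast
  have "(\<Prod>K\<leftarrow>Ks. 2 * length K) > 0" using Ks(1) by (induction Ks) auto
  then have "2 * tree_count ({x, y} \<union> set ws) (double_cone x y ws) C > 0"
    unfolding tree_count_double_cone[OF Ks ap(2)] by simp
  then show ?thesis by simp
qed

lemma joined_graph:
  assumes "complete_digraph 2 (with_proj K)" "pair_graph F"
  obtains x y es ws where "graph_join K F = graph_of ({x, y} \<union> set ws) (es @ double_cone x y ws)"
    "x \<noteq> y" "x \<notin> set ws" "y \<notin> set ws" "distinct ws" "length ws = card (pverts F)"
    "set es \<subseteq> set ws \<times> set ws" "simple_edges es"
proof -
  obtain p q where pq: "pverts K = {p, q}" "p \<noteq> q"
    using assms(1) by (auto simp: complete_digraph_def card_2_iff)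
  have K: "parcs K = {(p, q), (q, p)}"
    using assms(1) pq by (auto simp: complete_digraph_def)
  interpret F: pair_graph F by (rule assms(2))
  obtain vs where vs: "set vs = pverts F" "distinct vs"
    using finite_distinct_list[OF F.pair_finite_verts] by blast
  define ws :: "('a + 'b) list" where "ws = map Inr vs"
  have ws: "set ws = Inr ` pverts F" "distinct ws" using vs by (auto simp: ws_def distinct_map)
  define E :: "('a + 'b) rel" where "E = map_prod Inr Inr ` parcs F"
  have "finite E" using F.pair_finite_arcs by (simp add: E_def)
  moreover have "sym E" using F.pair_sym_arcs by (auto simp: E_def symmetric_def sym_def)
  moreover have "irrefl E" using F.pair_no_loops by (fastforce simp: E_def irrefl_def)
  ultimately obtain es where es: "simple_edges es" "set es \<union> (set es)\<inverse> = E"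
    by (rule edge_list_exists)
  have "E \<subseteq> set ws \<times> set ws" using F.in_arcsD1 F.in_arcsD2 by (auto simp: E_def ws)
  then have esW: "set es \<subseteq> set ws \<times> set ws" using es(2) by blast
  let ?x = "Inl p :: 'a + 'b" and ?y = "Inl q :: 'a + 'b"
  have "{(Inr u, Inr v) | u v. (u, v) \<in> parcs F} = E" by (auto simp: E_def)
  moreover have "{(Inl u, Inl v) | u v. (u, v) \<in> parcs K} = {(?x, ?y), (?y, ?x)}"
    unfolding K by auto
  moreover have "Inl ` pverts K = {?x, ?y}" using pq by auto
  moreover have "set (es @ double_cone ?x ?y ws) \<union> (set (es @ double_cone ?x ?y ws))\<inverse> =
      {(?x, ?y), (?y, ?x)} \<union> E \<union> {?x, ?y} \<times> set ws \<union> set ws \<times> {?x, ?y}"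
    unfolding es(2)[symmetric] by (auto simp: set_double_cone)
  ultimately have "graph_join K F = graph_of ({?x, ?y} \<union> set ws) (es @ double_cone ?x ?y ws)"
    by (simp add: graph_join_def graph_of_def ws)
  moreover have "length ws = card (pverts F)"
    using vs distinct_card[OF vs(2)] by (simp add: ws_def)
  ultimately show ?thesis
    using that[of ?x ?y ws es] pq ws es(1) esW by auto
qed

theorem theorem1p3:
  fixes K :: "'a pair_pre_digraph" and F :: "'b pair_pre_digraph"
    and G :: "('a + 'b) pair_pre_digraph" and n :: nat
  assumes "complete_digraph 2 (with_proj K)"
    and "pair_graph F" and "pverts F \<noteq> {}"
    and "G = graph_join K F"
    and "n = card (pverts G)"
  shows "(n \<ge> 4 \<longrightarrow> Q G \<ge> 27 / (real n)\<^sup>2 * (3 / 2) ^ (n - 4)) \<and>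
         (n = 3 \<longrightarrow> complete_digraph 3 (with_proj G) \<and> Q G = 4 / 3)"
proof -
  obtain x y es ws where G: "G = graph_of ({x, y} \<union> set ws) (es @ double_cone x y ws)"
    and xy: "x \<noteq> y" "x \<notin> set ws" "y \<notin> set ws" and ws: "distinct ws"
    and es: "set es \<subseteq> set ws \<times> set ws" "simple_edges es"
    using joined_graph[OF assms(1,2)] unfolding assms(4) by metis
  define V where "V = {x, y} \<union> set ws"
  define L where "L = es @ double_cone x y ws"
  note G' = G[folded V_def L_def]
  have V: "finite V" "V \<noteq> {}" by (auto simp: V_def)
  have LV: "set L \<subseteq> V \<times> V" using es(1) by (auto simp: L_def V_def set_double_cone)
  have simple: "simple_edges L"
    unfolding L_def simple_edges_append
    using es simple_edges_double_cone[OF ws xy(2,3,1)] xy by (auto simp: set_double_cone)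
  have n: "n = length ws + 2"
    using assms(5) xy distinct_card[OF ws] by (simp add: G graph_of_def)
  have apart: "apart {} x y (set ws)" using xy by (auto simp: apart_def)
  have x: "(x, v) \<in> linked (set L)" if "v \<in> V" for v
    using that by (cases "v = x") (auto intro: linked_edge simp: L_def V_def set_double_cone)
  have con: "V \<times> V \<subseteq> linked (set L)"
  proof clarify
    fix u v assume "u \<in> V" "v \<in> V"
    then show "(u, v) \<in> linked (set L)" using linked_trans[OF linked_sym[OF x] x] by blast
  qed
  have Q: "Q G = real (acyclic_count L {}) * real (strong_count V L {}) / (real (tree_count V L {}))\<^sup>2"
    unfolding Q_def G' num_acyclic_orientations_eq[OF simple LV]
      num_totally_cyclic_orientations_eq[OF simple LV con]
      num_spanning_trees_eq[OF simple LV V] ..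
  have pos: "real (tree_count V L {}) > 0"
    using tree_count_double_cone_pos[OF apart] tree_count_append_ge[of V "double_cone x y ws" "{}" es] by (simp add: V_def L_def)
  show ?thesis
  proof (intro conjI impI)
    assume "n \<ge> 4"
    then have "length ws \<ge> 2" using n by simp
    moreover have "\<forall>e\<in>set es. e \<notin> linked {}" using simple_edgesD[OF es(2)] by auto
    ultimately have "27 / (real n)\<^sup>2 * (3 / 2) ^ (n - 4) * (real (tree_count V L {}))\<^sup>2
        \<le> real (acyclic_count L {}) * real (strong_count V L {})"
      unfolding L_def using product_bound[OF apart _ V_def n es(1)] by blast
    then show "Q G \<ge> 27 / (real n)\<^sup>2 * (3 / 2) ^ (n - 4)"
      unfolding Q using pos by (simp add: le_divide_eq)
  next
    assume "n = 3"
    then have "length ws = 1" using n by simp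
    then obtain w where w: "ws = [w]" by (cases ws) auto
    have es0: "es = []" using es w simple_edgesD[OF es(2), of w w] by (cases es) auto
    interpret pair_graph G
      unfolding G' graph_of_def by (rule subset_pair_graph[OF simple LV V(1)]) simp
    have "graph (with_proj G)" by unfold_locales
    moreover have "parcs G = {(u, v). (u, v) \<in> pverts G \<times> pverts G \<and> u \<noteq> v}"
      using xy w by (auto simp: G graph_of_def es0 set_double_cone)
    ultimately show "complete_digraph 3 (with_proj G)"
      using assms(5) \<open>n = 3\<close> by (simp add: complete_digraph_def)
    have bl: "blocks {} x y [[w]]" "mset (concat [[w]]) = mset ws" "(x, y) \<notin> linked {}"
      using xy w by auto
    have "acyclic_count L {} = 6" using acyclic_count_double_cone[OF bl] by (simp add: L_def es0)
    moreover have "strong_count V L {} = 2" using strong_count_double_cone[OF bl] by (simp add: L_def es0 V_def)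
    moreover have "tree_count V L {} = 3" using tree_count_double_cone[OF bl] w by (simp add: L_def es0 V_def)
    ultimately show "Q G = 4 / 3" unfolding Q by (simp add: power2_eq_square)
  qed
qed

end
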